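(* The Hausdorff dimension of the two-dimensional attractor $\Lambda_P=\overline{\bigcap_{i\ge1}P^i(S^\star)}$ of the Poincaré map $P$ of a geometric Lorenz flow is strictly greater than $1$.
   Context: Geometric Lorenz flow. Fix real numbers $\lambda_1,\lambda_2,\lambda_3$ with $0<-\lambda_3<\lambda_1<-\lambda_2$ and put $\alpha=-\lambda_3/\lambda_1\in(0,1)$, $\beta=-\lambda_2/\lambda_1>1$. In the cube $[-1,1]^3$ the vector field $X$ is linear, $(\dot x,\dot y,\dot z)=(\lambda_1x,\lambda_2y,\lambda_3z)$, with singularity $O=(0,0,0)$. Let $I=[-1/2,1/2]$, $S=\{(x,y,1):|x|\le 1/2,|y|\le 1/2\}$, $\Gamma=\{(x,y,1)\in S:x=0\}$ (contained in the stable manifold of $O$), $S^\star=S\setminus\Gamma$. The orbit of $(x,y,1)\in S^\star$ leaves the cube through $\{|x|=1\}$ at the point $(\operatorname{sgn}(x),y|x|^\beta,|x|^\alpha)$. Outside the cube, the vector field carries these exit points back to the cross-section $S$, in bounded time, realizing a composition of a rotation, an expansion and a translation that takes segments $\{z=\text{const}\}$ of the exit section to segments $\{x=\text{const}\}$ of $S$; $S$ is transverse to the flow and every trajectory eventually crosses it. Identifying $(x,y,1)$ with $(x,y)$, the resulting Poincaré map $P:S^\star\to S$ has the form $P(x,y)=(f(x),g(x,y))$, where - $f(x)=f_0(|x|^\alpha)$ for $x>0$ and $f(x)=f_1(|x|^\alpha)$ for $x<0$, with $f_i(u)=(-1)^i\theta u+b_i$ ($i=0,1$), and $f:I\setminus\{0\}\to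 I$ satisfies: $f(0^-)=1/2$, $f(0^+)=-1/2$; $f'(x)>\sqrt2$ for all $x\in I\setminus\{0\}$; $f'(0^-)=f'(0^+)=+\infty$; $f(-1/2)\ne-1/2$ and $f(1/2)\neq 1/2$; - $g(x,y)=g_0(|x|^\alpha,y|x|^\beta)$ for $x>0$ and $g(x,y)=g_1(|x|^\alpha,y|x|^\beta)$ for $x<0$, with $g_0,g_1$ affine maps with values in $I$, such that $|\partial_yg|=|x|^\beta<\lambda$ for some $\lambda\in(0,1)$ and $|\partial_xg|$ is bounded. In the definition of $\Lambda_P$, $P^i$ is applied wherever it is defined. *)

theory Defs
  imports "HOL-Analysis.Analysis"
begin

section \<open>Hausdorff measure and Hausdorff dimension\<close>

text \<open>The summand \<open>diam(U)\<^sup>s\<close>, with the usual conventions that the empty set contributes \<open>0\<close> and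
  that \<open>diam(U)\<^sup>0 = 1\<close> for nonempty \<open>U\<close> (note that \<open>0 powr 0 = 0\<close> in the library).\<close>

definition hausdorff_gauge :: "real \<Rightarrow> 'a::metric_space set \<Rightarrow> ennreal" where
  "hausdorff_gauge s U =
     (if U = {} then 0 else if s = 0 then 1 else ennreal (diameter U powr s))"

text \<open>\<open>diameter\<close> is meaningful only for bounded sets, hence the explicit boundedness condition.\<close>

definition hausdorff_content :: "real \<Rightarrow> real \<Rightarrow> 'a::metric_space set \<Rightarrow> ennreal" where
  "hausdorff_content s \<delta> A =
     (INF U \<in> {U :: nat \<Rightarrow> 'a set. A \<subseteq> (\<Union>i. U i) \<and> (\<forall>i. bounded (U i) \<and> diameter (U i) \<le> \<delta>)}.
        (\<Sum>i. hausdorff_gauge s (U i)))"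

definition hausdorff_measure :: "real \<Rightarrow> 'a::metric_space set \<Rightarrow> ennreal" where
  "hausdorff_measure s A = (SUP \<delta> \<in> {0<..}. hausdorff_content s \<delta> A)"

definition hausdorff_dim :: "'a::metric_space set \<Rightarrow> ereal" where
  "hausdorff_dim A = (INF s \<in> {s. 0 \<le> s \<and> hausdorff_measure s A = 0}. ereal s)"


section \<open>Flows and first-return maps\<close>

definition flow_of :: "('a::real_normed_vector \<Rightarrow> 'a) \<Rightarrow> (real \<Rightarrow> 'a \<Rightarrow> 'a) \<Rightarrow> bool" where
  "flow_of X \<phi> \<longleftrightarrow>
     (\<forall>p. \<phi> 0 p = p) \<and>
     (\<forall>s t p. \<phi> (s + t) p = \<phi> s (\<phi> t p)) \<and>
     (\<forall>t p. ((\<lambda>t. \<phi> t p) has_vector_derivative X (\<phi> t p)) (at t))"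

definition first_return_time :: "(real \<Rightarrow> 'a \<Rightarrow> 'a) \<Rightarrow> 'a set \<Rightarrow> 'a \<Rightarrow> real" where
  "first_return_time \<phi> S p = Inf {t. 0 < t \<and> \<phi> t p \<in> S}"

definition first_return :: "(real \<Rightarrow> 'a \<Rightarrow> 'a) \<Rightarrow> 'a set \<Rightarrow> 'a \<Rightarrow> 'a" where
  "first_return \<phi> S p = \<phi> (first_return_time \<phi> S p) p"


section \<open>Geometric Lorenz flows\<close>

text \<open>Points of the phase space \<open>\<real>\<^sup>3\<close> are triples; the product metric on
  \<open>real \<times> real \<times> real\<close> (and on \<open>real \<times> real\<close>) is the Euclidean one.\<close>

definition lorenz_I :: "real set" where
  "lorenz_I = {-1/2..1/2}"

definition lorenz_cube :: "(real \<times> real \<times> real) set" where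
  "lorenz_cube = {-1..1} \<times> {-1..1} \<times> {-1..1}"

definition lorenz_section :: "(real \<times> real \<times> real) set" where
  "lorenz_section = {(x, y, z). x \<in> lorenz_I \<and> y \<in> lorenz_I \<and> z = 1}"

text \<open>The punctured section in the planar coordinates \<open>(x, y)\<close>, which stand for \<open>(x, y, 1)\<close>.\<close>

definition lorenz_Sstar :: "(real \<times> real) set" where
  "lorenz_Sstar = {(x, y). x \<in> lorenz_I \<and> y \<in> lorenz_I \<and> x \<noteq> 0}"

definition lorenz_P ::
    "(real \<Rightarrow> real \<times> real \<times> real \<Rightarrow> real \<times> real \<times> real) \<Rightarrow> real \<times> real \<Rightarrow> real \<times> real" where
  "lorenz_P \<phi> = (\<lambda>(x, y). case first_return \<phi> lorenz_section (x, y, 1) of (x', y', z') \<Rightarrow> (x', y'))"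

definition lorenz_f :: "real \<Rightarrow> real \<Rightarrow> (nat \<Rightarrow> real) \<Rightarrow> real \<Rightarrow> real" where
  "lorenz_f \<alpha> \<theta> b x =
     (let fbr = (\<lambda>i u. (-1) ^ i * \<theta> * u + b i)
      in if x > 0 then fbr 0 (\<bar>x\<bar> powr \<alpha>) else fbr 1 (\<bar>x\<bar> powr \<alpha>))"

definition lorenz_g :: "real \<Rightarrow> real \<Rightarrow> (nat \<Rightarrow> real \<times> real \<Rightarrow> real) \<Rightarrow> real \<Rightarrow> real \<Rightarrow> real" where
  "lorenz_g \<alpha> \<beta> g x y =
     (if x > 0 then g 0 (\<bar>x\<bar> powr \<alpha>, y * \<bar>x\<bar> powr \<beta>) else g 1 (\<bar>x\<bar> powr \<alpha>, y * \<bar>x\<bar> powr \<beta>))"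

text \<open>The formulas \<open>lorenz_f\<close> and \<open>lorenz_g\<close> make sense for every \<open>x \<noteq> 0\<close>, so at \<open>x = \<plusminus>1/2\<close> and
  \<open>y = \<plusminus>1/2\<close> the two-sided derivatives below agree with the one-sided ones on the section.

  No regularity of \<open>X\<close> outside the cube is needed beyond its having a flow. Since \<open>lorenz_P\<close> is the
  first-return map of a flow, injectivity of the return map on the punctured section is a
  consequence of the assumptions; it does not follow from the formulas for the return map.\<close>

locale geometric_lorenz_flow =
  fixes l1 l2 l3 \<alpha> \<beta> :: real
    and X :: "real \<times> real \<times> real \<Rightarrow> real \<times> real \<times> real"
    and \<phi> :: "real \<Rightarrow> real \<times> real \<times> real \<Rightarrow> real \<times> real \<times> real"
    and \<theta> :: real
    and b :: "nat \<Rightarrow> real"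
    and g :: "nat \<Rightarrow> real \<times> real \<Rightarrow> real"
  assumes eigenvalues: "0 < - l3" "- l3 < l1" "l1 < - l2"
    and alpha: "\<alpha> = - l3 / l1"
    and beta: "\<beta> = - l2 / l1"
    and flow: "flow_of X \<phi>"
    and linear_in_cube:
      "\<And>x y z. (x, y, z) \<in> lorenz_cube \<Longrightarrow> X (x, y, z) = (l1 * x, l2 * y, l3 * z)"
    and exit_points_return:
      "\<exists>T>0. \<forall>(x, y) \<in> lorenz_Sstar. \<exists>t \<in> {0<..T}.
         \<phi> t (sgn x, y * \<bar>x\<bar> powr \<beta>, \<bar>x\<bar> powr \<alpha>) \<in> lorenz_section \<and>
         (\<forall>s \<in> {0<..<t}. \<phi> s (sgn x, y * \<bar>x\<bar> powr \<beta>, \<bar>x\<bar> powr \<alpha>) \<notin> lorenz_cube)"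
    and P_form:
      "\<And>x y. (x, y) \<in> lorenz_Sstar \<Longrightarrow> lorenz_P \<phi> (x, y) = (lorenz_f \<alpha> \<theta> b x, lorenz_g \<alpha> \<beta> g x y)"
    and f_range: "\<And>x. x \<in> lorenz_I - {0} \<Longrightarrow> lorenz_f \<alpha> \<theta> b x \<in> lorenz_I"
    and f_at_0: "(lorenz_f \<alpha> \<theta> b \<longlongrightarrow> 1/2) (at_left 0)" "(lorenz_f \<alpha> \<theta> b \<longlongrightarrow> -1/2) (at_right 0)"
    and f_expanding: "\<And>x. x \<in> lorenz_I - {0} \<Longrightarrow> deriv (lorenz_f \<alpha> \<theta> b) x > sqrt 2"
    and f_deriv_at_0:
      "filterlim (deriv (lorenz_f \<alpha> \<theta> b)) at_top (at_left 0)"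
      "filterlim (deriv (lorenz_f \<alpha> \<theta> b)) at_top (at_right 0)"
    and f_ends: "lorenz_f \<alpha> \<theta> b (-1/2) \<noteq> -1/2" "lorenz_f \<alpha> \<theta> b (1/2) \<noteq> 1/2"
    and g_affine: "\<And>i. i < 2 \<Longrightarrow> \<exists>L c. linear L \<and> g i = (\<lambda>p. L p + c)"
    and g_range: "\<And>x y. (x, y) \<in> lorenz_Sstar \<Longrightarrow> lorenz_g \<alpha> \<beta> g x y \<in> lorenz_I"
    and g_deriv_y:
      "\<exists>r. 0 < r \<and> r < 1 \<and> (\<forall>(x, y) \<in> lorenz_Sstar.
         \<bar>deriv (\<lambda>y. lorenz_g \<alpha> \<beta> g x y) y\<bar> = \<bar>x\<bar> powr \<beta> \<and> \<bar>x\<bar> powr \<beta> < r)"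
    and g_deriv_x:
      "\<exists>B. \<forall>(x, y) \<in> lorenz_Sstar. \<bar>deriv (\<lambda>x. lorenz_g \<alpha> \<beta> g x y) x\<bar> \<le> B"


section \<open>The attractor\<close>

text \<open>The image \<open>F\<^sup>i(D)\<close> of the \<open>i\<close>-th iterate of a partial map \<open>F\<close> with domain \<open>D\<close>: only points
  whose first \<open>i\<close> iterates \<open>p, F p, \<dots>\<close> lie in \<open>D\<close> contribute.\<close>

definition iterate_image :: "('a \<Rightarrow> 'a) \<Rightarrow> 'a set \<Rightarrow> nat \<Rightarrow> 'a set" where
  "iterate_image F D i = (F ^^ i) ` {p. \<forall>j<i. (F ^^ j) p \<in> D}"

definition lorenz_attractor ::
    "(real \<Rightarrow> real \<times> real \<times> real \<Rightarrow> real \<times> real \<times> real) \<Rightarrow> (real \<times> real) set" where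
  "lorenz_attractor \<phi> = closure (\<Inter>i\<in>{1..}. iterate_image (lorenz_P \<phi>) lorenz_Sstar i)"

end

theory Submission
  imports Defs
begin

text \<open>The limits and the slope condition on \<open>f\<close> force it to be an odd map with two expanding branches, and
  slope \<open>> sqrt 2\<close> makes some iterate have two inverse branches defined on a common interval
  \<open>J\<close>, with all backward orbits bounded away from the singularity. So every \<open>t \<in> J\<close> carries a full
  binary tree of backward orbits of \<open>f\<close>. Each of them determines a point of \<open>\<Lambda>\<^sub>P\<close> over \<open>t\<close>,
  because \<open>P\<close> contracts vertical fibres. As a first-return map, \<open>P\<close> is injective; hence, by compactness, the
  two preimages of a vertical segment have images a definite distance apart, and the points of two
  backward orbits that separate at step \<open>n\<close> are at least \<open>\<kappa>\<^sup>n \<delta>\<close> apart. Therefore the binary expansion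
  gives a Hoelder map of exponent \<open>s > 0\<close> from part of each slice of \<open>\<Lambda>\<^sub>P\<close> over \<open>J\<close> onto \<open>[0, 1)\<close>, and
  integrating over \<open>t \<in> J\<close> bounds \<open>\<Sum>i. diam (U i) powr (1 + s)\<close> below for every cover \<open>U\<close>.\<close>

section \<open>Sets with large vertical slices\<close>

text \<open>By the Hoelder bound, the parameters \<open>v\<close> sent into one \<open>U i\<close>
  lie within \<open>C * diameter (U i) powr s\<close> of each other, so countable subadditivity of
  length on \<open>[0, 1)\<close> applies. The indicator records which sets meet the slice over
  \<open>t\<close>, ready for integration in \<open>t\<close>.\<close>

lemma one_le_suminf_slice_cover:
  fixes U :: "nat \<Rightarrow> (real \<times> real) set" and z :: "real \<Rightarrow> real"
  assumes s: "s > 0" and C: "C > 0"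
    and bdd: "\<And>i. bounded (U i)"
    and cover: "\<And>v. v \<in> {0..<1} \<Longrightarrow> (t, z v) \<in> (\<Union>i. U i)"
    and holder: "\<And>v w. v \<in> {0..<1} \<Longrightarrow> w \<in> {0..<1} \<Longrightarrow> \<bar>v - w\<bar> \<le> C * \<bar>z v - z w\<bar> powr s"
  shows "1 \<le> (\<Sum>i. ennreal (2 * C * diameter (U i) powr s) * indicator (fst ` U i) t)"
proof -
  define V where "V i = {v \<in> {0..<1}. (t, z v) \<in> U i}" for i
  \<comment> \<open>\<open>V i\<close> may fail to be measurable; a ball about one of its points
    contains it at the cost of a factor 2.\<close>
  define W where "W i = (if V i = {} then {} else cball (SOME v. v \<in> V i) (C * diameter (U i) powr s))" for i
  have VW: "V i \<subseteq> W i" for i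
  proof
    fix v assume v: "v \<in> V i"
    define w where "w = (SOME v. v \<in> V i)"
    have w: "w \<in> V i" unfolding w_def using v by (rule someI)
    have "\<bar>z w - z v\<bar> \<le> diameter (U i)"
      using diameter_bounded_bound[OF bdd, of "(t, z w)" i "(t, z v)"] v w
      by (simp add: V_def dist_Pair_Pair dist_real_def)
    then have "\<bar>z w - z v\<bar> powr s \<le> diameter (U i) powr s"
      using s by (intro powr_mono2) auto
    moreover have "\<bar>w - v\<bar> \<le> C * \<bar>z w - z v\<bar> powr s"
      using holder v w by (auto simp: V_def)
    ultimately have "\<bar>w - v\<bar> \<le> C * diameter (U i) powr s"
      using C by (meson mult_left_mono less_imp_le order_trans)
    then show "v \<in> W i"
      using v unfolding W_def w_def[symmetric] by (auto simp: dist_real_def)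
  qed
  have meas: "emeasure lborel (W i) \<le> ennreal (2 * C * diameter (U i) powr s) * indicator (fst ` U i) t" for i
  proof (cases "V i = {}")
    case False
    then have "t \<in> fst ` U i" by (force simp: V_def)
    then show ?thesis
      using False C by (simp add: W_def cball_eq_atLeastAtMost mult.assoc)
  qed (simp add: W_def)
  have "{0..<1} \<subseteq> (\<Union>i. W i)"
    using cover VW by (fastforce simp: V_def)
  then have "emeasure lborel {0..<1::real} \<le> emeasure lborel (\<Union>i. W i)"
    by (intro emeasure_mono) (auto simp: W_def)
  also have "\<dots> \<le> (\<Sum>i. emeasure lborel (W i))"
    by (intro emeasure_subadditive_countably) (auto simp: W_def)
  also have "\<dots> \<le> (\<Sum>i. ennreal (2 * C * diameter (U i) powr s) * indicator (fst ` U i) t)"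
    by (intro suminf_le meas) auto
  finally show ?thesis by simp
qed

text \<open>Integrating the slice bound over \<open>t\<close> supplies one more factor of the
  diameter, since \<open>U i\<close> projects into an interval of length
  \<open>2 * diameter (U i)\<close>.\<close>

lemma slice_cover_sum_ge:
  fixes U :: "nat \<Rightarrow> (real \<times> real) set" and Z :: "real \<Rightarrow> real \<Rightarrow> real"
  assumes ab: "a < b" and s: "s > 0" and C: "C > 0"
    and mem: "\<And>t v. t \<in> {a..b} \<Longrightarrow> v \<in> {0..<1} \<Longrightarrow> (t, Z t v) \<in> A"
    and holder: "\<And>t v w. t \<in> {a..b} \<Longrightarrow> v \<in> {0..<1} \<Longrightarrow> w \<in> {0..<1} \<Longrightarrow>
      \<bar>v - w\<bar> \<le> C * \<bar>Z t v - Z t w\<bar> powr s"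
    and bdd: "\<And>i. bounded (U i)" and cover: "A \<subseteq> (\<Union>i. U i)"
  shows "ennreal ((b - a) / (4 * C)) \<le> (\<Sum>i. ennreal (diameter (U i) powr (1 + s)))"
proof -
  define d where "d i = diameter (U i)" for i
  have d0: "d i \<ge> 0" for i unfolding d_def using bdd by (simp add: diameter_ge_0)
  \<comment> \<open>An interval again stands in for a possibly non-measurable set, here the
    projection of \<open>U i\<close>.\<close>
  define J where "J i = (if U i = {} then {} else cball (fst (SOME p. p \<in> U i)) (d i))" for i
  have UJ: "fst ` U i \<subseteq> J i" for i
  proof
    fix t assume "t \<in> fst ` U i"
    then obtain p where p: "p \<in> U i" "t = fst p" by auto
    have q: "(SOME p. p \<in> U i) \<in> U i" using p(1) by (rule someI)
    have "dist (fst (SOME p. p \<in> U i)) (fst p) \<le> d i"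
      unfolding d_def using diameter_bounded_bound[OF bdd q p(1)] dist_fst_le order_trans by blast
    then show "t \<in> J i" using p by (auto simp: J_def)
  qed
  have measJ: "emeasure lborel (J i) \<le> ennreal (2 * d i)" for i
    using d0[of i] by (simp add: J_def cball_eq_atLeastAtMost)
  have "ennreal (b - a) = (\<integral>\<^sup>+t. indicator {a..b} t \<partial>lborel)"
    using ab by simp
  also have "\<dots> \<le> (\<integral>\<^sup>+t. (\<Sum>i. ennreal (2 * C * d i powr s) * indicator (J i) t) \<partial>lborel)"
  proof (rule nn_integral_mono)
    fix t :: real
    have "1 \<le> (\<Sum>i. ennreal (2 * C * d i powr s) * indicator (J i) t)" if t: "t \<in> {a..b}"
    proof -
      have covers: "(t, Z t v) \<in> (\<Union>i. U i)" if "v \<in> {0..<1}" for v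
        using mem[OF t that] cover by blast
      have "1 \<le> (\<Sum>i. ennreal (2 * C * d i powr s) * indicator (fst ` U i) t)"
        unfolding d_def
        by (rule one_le_suminf_slice_cover[where z = "Z t"])
          (use s C bdd covers holder[OF t] in auto)
      also have "\<dots> \<le> (\<Sum>i. ennreal (2 * C * d i powr s) * indicator (J i) t)"
        using UJ by (intro suminf_le mult_left_mono) (auto simp: indicator_def)
      finally show ?thesis .
    qed
    then show "indicator {a..b} t \<le> (\<Sum>i. ennreal (2 * C * d i powr s) * indicator (J i) t)"
      by (auto simp: indicator_def)
  qed
  also have "\<dots> = (\<Sum>i. \<integral>\<^sup>+t. ennreal (2 * C * d i powr s) * indicator (J i) t \<partial>lborel)"
    by (intro nn_integral_suminf) (auto simp: J_def)
  also have "\<dots> = (\<Sum>i. ennreal (2 * C * d i powr s) * emeasure lborel (J i))"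
    by (intro suminf_cong nn_integral_cmult_indicator) (auto simp: J_def)
  also have "\<dots> \<le> (\<Sum>i. ennreal (4 * C) * ennreal (d i powr (1 + s)))"
  proof (intro suminf_le)
    fix i
    have "ennreal (2 * C * d i powr s) * emeasure lborel (J i) \<le> ennreal (2 * C * d i powr s) * ennreal (2 * d i)"
      by (intro mult_left_mono measJ) auto
    also have "\<dots> = ennreal (4 * C) * ennreal (d i powr (1 + s))"
      using d0[of i] C by (cases "d i = 0") (simp_all add: ennreal_mult[symmetric] powr_add)
    finally show "ennreal (2 * C * d i powr s) * emeasure lborel (J i) \<le> ennreal (4 * C) * ennreal (d i powr (1 + s))" .
  qed auto
  also have "\<dots> = ennreal (4 * C) * (\<Sum>i. ennreal (d i powr (1 + s)))"
    by simp
  finally have "ennreal (1 / (4 * C)) * ennreal (b - a) \<le> ennreal (1 / (4 * C)) * (ennreal (4 * C) * (\<Sum>i. ennreal (d i powr (1 + s))))"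
    by (rule mult_left_mono) auto
  also have "\<dots> = (\<Sum>i. ennreal (d i powr (1 + s)))"
    using C by (simp add: mult.assoc[symmetric] ennreal_mult[symmetric] del: ennreal_suminf_cmult)
  also have "ennreal (1 / (4 * C)) * ennreal (b - a) = ennreal ((b - a) / (4 * C))"
    using C ab by (simp add: ennreal_mult[symmetric])
  finally show ?thesis unfolding d_def .
qed

text \<open>If \<open>r < 1 + s\<close>, then for sets of diameter at most 1 the gauge of exponent
  \<open>r\<close> dominates \<open>diameter (U i) powr (1 + s)\<close>. The content at scale 1 is
  then already positive, so no such \<open>r\<close> enters the infimum.\<close>

lemma hausdorff_dim_ge_of_holder_slices:
  fixes A :: "(real \<times> real) set" and Z :: "real \<Rightarrow> real \<Rightarrow> real"
  assumes ab: "a < b" and s: "s > 0" and C: "C > 0"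
    and mem: "\<And>t v. t \<in> {a..b} \<Longrightarrow> v \<in> {0..<1} \<Longrightarrow> (t, Z t v) \<in> A"
    and holder: "\<And>t v w. t \<in> {a..b} \<Longrightarrow> v \<in> {0..<1} \<Longrightarrow> w \<in> {0..<1} \<Longrightarrow>
      \<bar>v - w\<bar> \<le> C * \<bar>Z t v - Z t w\<bar> powr s"
  shows "hausdorff_dim A \<ge> ereal (1 + s)"
  unfolding hausdorff_dim_def
proof (rule INF_greatest, clarify, rule ccontr)
  fix r :: real
  assume r: "0 \<le> r" and null: "hausdorff_measure r A = 0" and "\<not> ereal (1 + s) \<le> ereal r"
  then have rs: "r < 1 + s" by simp
  have "ennreal ((b - a) / (4 * C)) \<le> hausdorff_content r 1 A"
    unfolding hausdorff_content_def
  proof (rule INF_greatest, clarify)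
    fix U :: "nat \<Rightarrow> (real \<times> real) set"
    assume cover: "A \<subseteq> (\<Union>i. U i)" and U: "\<forall>i. bounded (U i) \<and> diameter (U i) \<le> 1"
    have "ennreal ((b - a) / (4 * C)) \<le> (\<Sum>i. ennreal (diameter (U i) powr (1 + s)))"
      by (rule slice_cover_sum_ge[OF ab s C mem holder _ cover]) (use U in auto)
    also have "\<dots> \<le> (\<Sum>i. hausdorff_gauge r (U i))"
    proof (intro suminf_le)
      fix i
      have d: "0 \<le> diameter (U i)" "diameter (U i) \<le> 1"
        using U by (auto simp: diameter_ge_0)
      have "diameter (U i) powr (1 + s) \<le> diameter (U i) powr r"
        using d rs by (intro powr_mono') auto
      \<comment> \<open>This serves the case \<open>r = 0\<close>, where a nonempty set has gauge 1
        by convention.\<close>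
      moreover have "diameter (U i) powr (1 + s) \<le> 1"
        using d s by (intro powr_le1) auto
      ultimately show "ennreal (diameter (U i) powr (1 + s)) \<le> hausdorff_gauge r (U i)"
        unfolding hausdorff_gauge_def using s by (auto simp: diameter_empty ennreal_leI)
    qed auto
    finally show "ennreal ((b - a) / (4 * C)) \<le> (\<Sum>i. hausdorff_gauge r (U i))" .
  qed
  also have "\<dots> \<le> hausdorff_measure r A"
    unfolding hausdorff_measure_def by (rule SUP_upper) simp
  finally show False using null ab C by (simp add: divide_le_0_iff)
qed

text \<open>The digit of weight \<open>2^-(i+1)\<close>; the floor selects the terminating expansion
  of a dyadic number.\<close>

definition binary_digit :: "real \<Rightarrow> nat \<Rightarrow> bool" where
  "binary_digit v i = odd \<lfloor>v * 2 ^ Suc i\<rfloor>"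

text \<open>\<open>Suc n\<close> is the first level at which the floors of \<open>v * 2 ^ m\<close>
  and \<open>w * 2 ^ m\<close> differ. Agreement at level \<open>n\<close> bounds the distance, and
  since the next floor is twice the old one plus a digit, the digits must differ.\<close>

lemma ex_first_differing_digit:
  assumes "v \<in> {0..<1}" "w \<in> {0..<1}" "v \<noteq> w"
  obtains n where "\<And>i. i < n \<Longrightarrow> binary_digit v i = binary_digit w i"
    "binary_digit v n \<noteq> binary_digit w n" "\<bar>v - w\<bar> \<le> (1/2) ^ n"
proof -
  define D where "D m \<longleftrightarrow> \<lfloor>v * 2 ^ m\<rfloor> \<noteq> \<lfloor>w * 2 ^ m\<rfloor>" for m :: nat
  have close: "\<bar>v - w\<bar> < (1/2) ^ m" if "\<not> D m" for m
  proof -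
    have "\<bar>v * 2 ^ m - w * 2 ^ m\<bar> < 1" using that unfolding D_def by linarith
    then have "\<bar>v - w\<bar> * 2 ^ m < 1" by (simp add: abs_mult flip: left_diff_distrib)
    then show ?thesis by (simp add: field_simps)
  qed
  have "\<exists>m. D m"
  proof (rule ccontr)
    assume "\<nexists>m. D m"
    then have "\<bar>v - w\<bar> < (1/2) ^ m" for m using close by blast
    moreover obtain m where "(1/2::real) ^ m < \<bar>v - w\<bar>"
      using real_arch_pow_inv[of "\<bar>v - w\<bar>" "1/2"] assms(3) by auto
    ultimately show False by (meson less_asym)
  qed
  define m where "m = (LEAST m. D m)"
  have Dm: "D m" unfolding m_def using \<open>\<exists>m. D m\<close> by (rule LeastI_ex)
  have below: "\<not> D k" if "k < m" for k using that unfolding m_def by (rule not_less_Least)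
  have "\<lfloor>v\<rfloor> = 0" "\<lfloor>w\<rfloor> = 0" using assms by (auto simp: floor_eq_iff)
  then have "\<not> D 0" by (simp add: D_def)
  then obtain n where n: "m = Suc n" using Dm by (cases m) auto
  have half: "\<lfloor>x * 2 ^ Suc n\<rfloor> = 2 * \<lfloor>x * 2 ^ n\<rfloor> \<or> \<lfloor>x * 2 ^ Suc n\<rfloor> = 2 * \<lfloor>x * 2 ^ n\<rfloor> + 1" for x :: real
  proof -
    have "x * 2 ^ Suc n = 2 * (x * 2 ^ n)" by simp
    then show ?thesis by linarith
  qed
  show ?thesis
  proof (rule that[of n])
    show "binary_digit v i = binary_digit w i" if "i < n" for i
      using below[of "Suc i"] that n by (simp add: D_def binary_digit_def)
    show "binary_digit v n \<noteq> binary_digit w n"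
    proof
      assume eq: "binary_digit v n = binary_digit w n"
      have "\<lfloor>v * 2 ^ n\<rfloor> = \<lfloor>w * 2 ^ n\<rfloor>" using below[of n] n by (simp add: D_def)
      then have "\<lfloor>v * 2 ^ Suc n\<rfloor> = \<lfloor>w * 2 ^ Suc n\<rfloor>"
        using half[of v] half[of w] eq unfolding binary_digit_def by presburger
      then show False using Dm n by (simp add: D_def)
    qed
    show "\<bar>v - w\<bar> \<le> (1/2) ^ n" using close[OF below[of n]] n by simp
  qed
qed

section \<open>Backward orbits of the one-dimensional map\<close>

locale lorenz_branches =
  fixes \<alpha> \<theta> :: real
  assumes alpha_bounds: "0 < \<alpha>" "\<alpha> < 1" and theta_pos: "\<theta> > 0"
    and slope: "\<theta> * \<alpha> * (1/2) powr (\<alpha> - 1) > sqrt 2"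
begin

text \<open>As \<alpha> < 1, the derivative is decreasing, so it is at least its value at
  \<open>1/2\<close>, which \<open>slope\<close> bounds. The mean value theorem asks for derivatives
  only in the open interval, which admits \<open>a = 0\<close>.\<close>

lemma powr_expanding:
  assumes "0 \<le> a" "a < b" "b \<le> 1/2"
  shows "sqrt 2 * (b - a) < \<theta> * b powr \<alpha> - \<theta> * a powr \<alpha>"
proof -
  have "continuous_on {a..b} (\<lambda>x. \<theta> * x powr \<alpha>)"
    using assms alpha_bounds by (intro continuous_on_mult continuous_on_powr' continuous_intros) auto
  moreover have "((\<lambda>x. \<theta> * x powr \<alpha>) has_derivative (*) (\<theta> * (\<alpha> * x powr (\<alpha> - 1)))) (at x)"
    if "a < x" "x < b" for x
  proof -
    have "((\<lambda>x. \<theta> * x powr \<alpha>) has_real_derivative \<theta> * (\<alpha> * x powr (\<alpha> - 1))) (at x)"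
      using that assms by (intro DERIV_cmult has_real_derivative_powr) auto
    then show ?thesis by (simp add: has_field_derivative_def)
  qed
  ultimately obtain z where z: "a < z" "z < b"
    and eq: "\<theta> * b powr \<alpha> - \<theta> * a powr \<alpha> = \<theta> * (\<alpha> * z powr (\<alpha> - 1)) * (b - a)"
    by (rule mvt[OF assms(2)])
  have "(1/2) powr (\<alpha> - 1) \<le> z powr (\<alpha> - 1)"
    using z assms alpha_bounds by (intro powr_mono2') auto
  then have "\<theta> * \<alpha> * (1/2) powr (\<alpha> - 1) \<le> \<theta> * \<alpha> * z powr (\<alpha> - 1)"
    using alpha_bounds theta_pos by (intro mult_left_mono) auto
  then have "sqrt 2 < \<theta> * (\<alpha> * z powr (\<alpha> - 1))" using slope by (simp add: mult.assoc)
  then have "sqrt 2 * (b - a) < \<theta> * (\<alpha> * z powr (\<alpha> - 1)) * (b - a)"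
    using assms by (intro mult_strict_right_mono) auto
  then show ?thesis by (simp add: eq)
qed

text \<open>Once \<open>b 0 = -1/2\<close> and \<open>b 1 = 1/2\<close> are known, the one-dimensional map is the odd map
  \<open>x \<mapsto> \<theta> x powr \<alpha> - 1/2\<close> (\<open>x > 0\<close>); the two preimages of \<open>t\<close> are \<open>br t\<close> and \<open>- br (- t)\<close>.\<close>

definition br :: "real \<Rightarrow> real" where
  "br t = ((1/2 + t) / \<theta>) powr (1 / \<alpha>)"

lemma br_nonneg: "0 \<le> br t"
  by (simp add: br_def)

lemma br_pos: "-1/2 < t \<Longrightarrow> 0 < br t"
  using theta_pos by (simp add: br_def)

lemma br_powr: "-1/2 \<le> t \<Longrightarrow> \<theta> * br t powr \<alpha> = 1/2 + t"
  using theta_pos alpha_bounds by (simp add: br_def powr_powr)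

lemma br_mono: "-1/2 \<le> s \<Longrightarrow> s \<le> t \<Longrightarrow> br s \<le> br t"
  unfolding br_def using theta_pos alpha_bounds by (intro powr_mono2) (auto simp: divide_right_mono)

lemma br_strict_mono: "-1/2 \<le> s \<Longrightarrow> s < t \<Longrightarrow> br s < br t"
  unfolding br_def using theta_pos alpha_bounds by (intro powr_less_mono2) (auto simp: divide_strict_right_mono)

lemma br_eqI: "0 \<le> u \<Longrightarrow> \<theta> * u powr \<alpha> = 1/2 + t \<Longrightarrow> br t = u"
  using theta_pos alpha_bounds by (auto simp: br_def powr_powr field_simps dest!: sym[of "_ * _"])

text \<open>The value of the right branch at \<open>1/2\<close>, hence the largest \<open>t\<close>
  for which \<open>br t\<close> stays in the interval.\<close>

definition top_value :: real where
  "top_value = \<theta> * (1/2) powr \<alpha> - 1/2"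

lemma br_top_value: "br top_value = 1/2"
  by (rule br_eqI) (auto simp: top_value_def)

lemma top_value_gt: "top_value > (sqrt 2 - 1) / 2"
  using powr_expanding[of 0 "1/2"] alpha_bounds by (simp add: top_value_def field_simps)

lemma top_value_pos: "top_value > 0"
  using top_value_gt by (smt (verit) real_sqrt_gt_1_iff divide_pos_pos)

lemma br_less_half: "-1/2 \<le> t \<Longrightarrow> t < top_value \<Longrightarrow> br t < 1/2"
  using br_strict_mono[of t top_value] by (simp add: br_top_value)

lemma br_contracting:
  assumes "-1/2 \<le> s" "s < t" "t \<le> top_value"
  shows "sqrt 2 * (br t - br s) < t - s"
proof -
  have "br t \<le> 1/2" using br_mono[of t top_value] assms by (simp add: br_top_value)
  then show ?thesis
    using powr_expanding[of "br s" "br t"] br_strict_mono[of s t] br_powr[of s] br_powr[of t] assms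
    by (simp add: br_nonneg)
qed

text \<open>The inequality \<open>q < top_value\<close> is where slope \<open>> sqrt 2\<close> is used: it makes both preimages of points
  near \<open>\<plusminus>q\<close> available inside the interval.\<close>

lemma ex_fixed_point:
  obtains q where "0 < q" "q < top_value" "q < 1/2" "br (- q) = q"
proof -
  have "\<exists>q\<ge>0. q \<le> 1/2 \<and> \<theta> * q powr \<alpha> + q = 1/2"
  proof (rule IVT')
    show "continuous_on {0..1/2} (\<lambda>q. \<theta> * q powr \<alpha> + q)"
      using alpha_bounds by (intro continuous_on_add continuous_on_mult continuous_on_powr' continuous_intros) auto
  qed (use alpha_bounds theta_pos in auto)
  then obtain q where q: "0 \<le> q" "q \<le> 1/2" "\<theta> * q powr \<alpha> + q = 1/2" by blast
  have fixed: "br (- q) = q" using q by (intro br_eqI) auto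
  have "q \<noteq> 0" using q by (intro notI) simp
  then have q0: "0 < q" using q by simp
  have q1: "q < 1/2" using q q0 theta_pos by (smt (verit) mult_pos_pos powr_gt_zero)
  \<comment> \<open>Contraction between \<open>-1/2\<close>, where \<open>br\<close> vanishes, and
    \<open>- q\<close> gives \<open>(1 + sqrt 2) * q < 1/2\<close>, that is,
    \<open>q < (sqrt 2 - 1) / 2\<close>, which is below \<open>top_value\<close>.\<close>
  have a: "sqrt 2 * q < 1/2 - q"
    using br_contracting[of "-1/2" "- q"] q1 q0 top_value_pos fixed by (simp add: br_def)
  have b: "sqrt 2 * (br 0 - q) < q"
    using br_contracting[of "- q" 0] q1 q0 top_value_pos fixed by simp
  have c: "sqrt 2 * (1/2 - br 0) < top_value"
    using br_contracting[of 0 top_value] top_value_pos br_top_value by simp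
  have s: "sqrt 2 * sqrt 2 = (2::real)" by simp
  have "(1 + sqrt 2) * q < 1/2" using a by (simp add: algebra_simps)
  then have "(sqrt 2 - 1) * ((1 + sqrt 2) * q) < (sqrt 2 - 1) * (1/2)"
    by (intro mult_strict_left_mono) auto
  moreover have "(sqrt 2 - 1) * ((1 + sqrt 2) * q) = (sqrt 2 * sqrt 2 - 1) * q"
    by (simp add: algebra_simps)
  ultimately have "q < (sqrt 2 - 1) * (1/2)" unfolding s by simp
  moreover have "(sqrt 2 - 1) * (1/2) < top_value" using top_value_gt by simp
  ultimately show ?thesis using that[OF q0 _ q1 fixed] by linarith
qed

text \<open>\<open>inner\<close> is the preimage of smaller modulus: it always exists, and iterating it drives \<open>\<bar>t\<bar>\<close>
  to the fixed point \<open>q\<close>. \<open>outer\<close>, the other preimage, lies in the interval only if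
  \<open>\<bar>t\<bar> \<le> top_value\<close>.\<close>

definition inner :: "real \<Rightarrow> real" where
  "inner t = (if t > 0 then - br (- t) else br t)"

definition outer :: "real \<Rightarrow> real" where
  "outer t = (if t > 0 then br t else - br (- t))"

lemma abs_inner: "\<bar>inner t\<bar> = br (- \<bar>t\<bar>)"
  and abs_outer: "\<bar>outer t\<bar> = br \<bar>t\<bar>"
  by (auto simp: inner_def outer_def br_nonneg)

text \<open>The strict bound keeps both preimages away from 0. Opposite signs are what
  \<open>ex_gap\<close> later converts into a vertical distance.\<close>

lemma inner_outer_opposite: "\<bar>t\<bar> < 1/2 \<Longrightarrow> inner t * outer t < 0"
  using br_pos[of t] br_pos[of "- t"]
  by (auto simp: inner_def outer_def mult_neg_pos mult_pos_neg)

text \<open>Backward orbits in blocks of length \<open>K + 1\<close>: \<open>K\<close> inner steps to get close to \<open>\<plusminus>q\<close>, then a free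
  choice of the preimage, governed by the next bit of \<open>\<omega>\<close>.\<close>

primrec hist :: "nat \<Rightarrow> (nat \<Rightarrow> bool) \<Rightarrow> real \<Rightarrow> nat \<Rightarrow> real" where
  "hist K \<omega> t 0 = t"
| "hist K \<omega> t (Suc k) =
    (if k mod Suc K = K \<and> \<omega> (k div Suc K) then outer (hist K \<omega> t k) else inner (hist K \<omega> t k))"

text \<open>On moduli, \<open>inner\<close> contracts towards \<open>q\<close> by the factor
  \<open>1 / sqrt 2\<close>. After \<open>K\<close> inner steps the modulus is below a bound \<mu> <
  \<open>top_value\<close>, so \<open>outer\<close> is available too, and either choice returns to
  the same range.\<close>

lemma ex_uniform_histories:
  obtains K r \<epsilon> where "0 < \<epsilon>" "0 < r" "r < 1/2"
    "\<And>\<omega> t k. \<bar>t\<bar> \<le> r \<Longrightarrow> \<bar>hist K \<omega> t k\<bar> \<le> r"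
    "\<And>\<omega> t k. \<bar>t\<bar> \<le> r \<Longrightarrow> \<epsilon> \<le> \<bar>hist K \<omega> t (Suc k)\<bar>"
proof -
  obtain q where q: "0 < q" "q < top_value" "q < 1/2" "br (- q) = q"
    by (rule ex_fixed_point)
  define \<mu> where "\<mu> = (q + top_value) / 2"
  have \<mu>: "0 < \<mu>" "\<mu> < top_value" "q < \<mu>" using q by (auto simp: \<mu>_def)
  define \<sigma> where "\<sigma> = 1 / sqrt (2::real)"
  have \<sigma>: "0 < \<sigma>" "\<sigma> < 1" by (auto simp: \<sigma>_def)
  have "(\<lambda>n. \<sigma> ^ n) \<longlonglongrightarrow> 0" using \<sigma> by (intro LIMSEQ_power_zero) auto
  then have "eventually (\<lambda>n. \<sigma> ^ n < \<mu> - q) sequentially" using \<mu> by (intro order_tendstoD) auto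
  then obtain K where K: "\<sigma> ^ K < \<mu> - q" unfolding eventually_sequentially by blast
  \<comment> \<open>\<open>r\<close> bounds every preimage in use because \<open>br\<close> is
    increasing, and \<open>br (- r)\<close> is the least modulus such a preimage can have.\<close>
  define r where "r = br \<mu>"
  define \<epsilon> where "\<epsilon> = br (- r)"
  have r: "0 < r" "r < 1/2" using \<mu> br_pos[of \<mu>] br_less_half[of \<mu>] by (auto simp: r_def)
  have \<epsilon>0: "0 < \<epsilon>" using br_pos[of "- r"] r by (simp add: \<epsilon>_def)
  have inner: "\<epsilon> \<le> \<bar>inner t\<bar> \<and> \<bar>inner t\<bar> \<le> r \<and> \<bar>\<bar>inner t\<bar> - q\<bar> \<le> \<sigma> * \<bar>\<bar>t\<bar> - q\<bar>" if t: "\<bar>t\<bar> \<le> r" for t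
  proof -
    have "\<bar>br (- \<bar>t\<bar>) - br (- q)\<bar> \<le> \<sigma> * \<bar>\<bar>t\<bar> - q\<bar>"
      using br_contracting[of "- q" "- \<bar>t\<bar>"] br_contracting[of "- \<bar>t\<bar>" "- q"]
        br_strict_mono[of "- q" "- \<bar>t\<bar>"] br_strict_mono[of "- \<bar>t\<bar>" "- q"] t q r
        order_trans[OF _ less_imp_le[OF top_value_pos], of "- \<bar>t\<bar>"]
      by (cases "\<bar>t\<bar>" q rule: linorder_cases) (simp_all add: \<sigma>_def field_simps)
    then show ?thesis
      using br_mono[of "- r" "- \<bar>t\<bar>"] br_mono[of "- \<bar>t\<bar>" \<mu>] t r \<mu> q
      by (simp add: abs_inner \<epsilon>_def r_def)
  qed
  have outer: "\<epsilon> \<le> \<bar>outer t\<bar> \<and> \<bar>outer t\<bar> \<le> r" if t: "\<bar>t\<bar> \<le> \<mu>" for t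
    using br_mono[of "- r" "\<bar>t\<bar>"] br_mono[of "\<bar>t\<bar>" \<mu>] t r by (simp add: abs_outer \<epsilon>_def r_def)
  \<comment> \<open>The exponent counts the inner steps of the current block. It resets to 0 after a
    free choice, where the bound 1 is trivial.\<close>
  define P where "P \<omega> t k \<longleftrightarrow> \<bar>hist K \<omega> t k\<bar> \<le> r \<and> \<bar>\<bar>hist K \<omega> t k\<bar> - q\<bar> \<le> \<sigma> ^ (k mod Suc K)" for \<omega> t k
  have step: "P \<omega> t (Suc k) \<and> \<epsilon> \<le> \<bar>hist K \<omega> t (Suc k)\<bar>" if "P \<omega> t k" for \<omega> t k
  proof -
    define x where "x = hist K \<omega> t k"
    have x: "\<bar>x\<bar> \<le> r" "\<bar>\<bar>x\<bar> - q\<bar> \<le> \<sigma> ^ (k mod Suc K)"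
      using that by (auto simp: P_def x_def)
    have near: "\<bar>\<bar>y\<bar> - q\<bar> \<le> 1" if "\<bar>y\<bar> \<le> r" for y
      using that r q by auto
    show ?thesis
    proof (cases "k mod Suc K = K")
      case True
      then have "Suc k mod Suc K = 0" by (simp add: mod_Suc)
      moreover have "\<bar>x\<bar> \<le> \<mu>" using x(2) K True by auto
      ultimately show ?thesis
        using inner[OF x(1)] outer[of x] near by (auto simp: P_def x_def)
    next
      case False
      then have m: "Suc k mod Suc K = Suc (k mod Suc K)" by (simp add: mod_Suc)
      have "\<sigma> * \<bar>\<bar>x\<bar> - q\<bar> \<le> \<sigma> * \<sigma> ^ (k mod Suc K)"
        using x(2) \<sigma> by (intro mult_left_mono) auto
      then show ?thesis
        using inner[OF x(1)] False by (auto simp: P_def x_def[symmetric] m simp del: mod_Suc)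
    qed
  qed
  have inv: "P \<omega> t k" if "\<bar>t\<bar> \<le> r" for \<omega> t k
    using that r q by (induction k) (use step in \<open>auto simp: P_def\<close>)
  have "\<bar>hist K \<omega> t k\<bar> \<le> r" if "\<bar>t\<bar> \<le> r" for \<omega> t k
    using inv[OF that] by (simp add: P_def)
  moreover have "\<epsilon> \<le> \<bar>hist K \<omega> t (Suc k)\<bar>" if "\<bar>t\<bar> \<le> r" for \<omega> t k
    using step inv[OF that] by blast
  ultimately show ?thesis using that[OF \<epsilon>0 r] by blast
qed

text \<open>Bit \<open>i\<close> is first used in passing from index \<open>i * Suc K + K\<close> to
  the next one.\<close>

lemma hist_cong_prefix:
  assumes "\<And>i. i < n \<Longrightarrow> \<omega> i = \<omega>' i" and "k \<le> n * Suc K + K"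
  shows "hist K \<omega> t k = hist K \<omega>' t k"
  using assms(2)
proof (induction k)
  case (Suc k)
  have "k div Suc K < n" if "k mod Suc K = K"
  proof -
    have "k = k div Suc K * Suc K + K" using that div_mult_mod_eq[of k "Suc K"] by simp
    then have "k div Suc K * Suc K < n * Suc K" using Suc.prems by linarith
    then show ?thesis by (simp only: mult_less_cancel2)
  qed
  then show ?case using Suc assms(1) by auto
qed simp

text \<open>When bit \<open>n\<close> is read the two orbits still coincide, so one moves to
  \<open>inner\<close> and the other to \<open>outer\<close> of the same point.\<close>

lemma hist_opposite:
  assumes pre: "\<And>i. i < n \<Longrightarrow> \<omega> i = \<omega>' i" and diff: "\<omega> n \<noteq> \<omega>' n"
    and small: "\<bar>hist K \<omega> t (n * Suc K + K)\<bar> < 1/2"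
  shows "hist K \<omega> t (Suc (n * Suc K + K)) * hist K \<omega>' t (Suc (n * Suc K + K)) < 0"
proof -
  have "(n * Suc K + K) mod Suc K = K" "(n * Suc K + K) div Suc K = n"
    by (simp_all del: mult_Suc_right)
  moreover have "hist K \<omega> t (n * Suc K + K) = hist K \<omega>' t (n * Suc K + K)"
    by (rule hist_cong_prefix[OF pre order_refl])
  ultimately show ?thesis
    using inner_outer_opposite[OF small] diff
    by (auto simp: mult.commute simp del: mult_Suc_right)
qed

end

section \<open>Injectivity of the return map\<close>

text \<open>The integrating factor \<open>exp (- l * s)\<close> makes the product with
  \<open>u\<close> constant.\<close>

lemma linear_ode_unique:
  fixes u :: "real \<Rightarrow> real"
  assumes "0 \<le> t" and "\<And>s. s \<in> {0..t} \<Longrightarrow> (u has_real_derivative l * u s) (at s)"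
  shows "u t = u 0 * exp (l * t)"
proof -
  have "((\<lambda>s. exp (- l * s) * u s) has_real_derivative 0) (at s within {0..t})" if "s \<in> {0..t}" for s
    by (rule derivative_eq_intros has_field_derivative_at_within[OF assms(2)[OF that]] refl | simp)+
  then have "\<exists>c. \<forall>s\<in>{0..t}. exp (- l * s) * u s = c"
    by (intro has_field_derivative_zero_constant) auto
  then have "exp (- l * t) * u t = u 0"
    using assms(1) by force
  then have "exp (l * t) * (exp (- l * t) * u t) = u 0 * exp (l * t)"
    by simp
  then show ?thesis
    by (simp add: mult.assoc[symmetric] exp_add[symmetric])
qed

section \<open>The passage through the cube\<close>

context geometric_lorenz_flow
begin

lemma l1_pos: "l1 > 0" and l2_neg: "l2 < 0" and l3_neg: "l3 < 0"
  using eigenvalues by auto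

lemma flow_zero: "\<phi> 0 p = p"
  and flow_add: "\<phi> (s + t) p = \<phi> s (\<phi> t p)"
  and flow_deriv: "((\<lambda>t. \<phi> t p) has_vector_derivative X (\<phi> t p)) (at t)"
  using flow unfolding flow_of_def by blast+

lemma continuous_on_flow: "continuous_on A (\<lambda>t. \<phi> t p)"
  by (rule continuous_at_imp_continuous_on) (blast intro: has_vector_derivative_continuous flow_deriv)

lemma flow_deriv_in_cube:
  assumes "\<phi> t p \<in> lorenz_cube"
  shows "((\<lambda>t. fst (\<phi> t p)) has_real_derivative l1 * fst (\<phi> t p)) (at t)"
    and "((\<lambda>t. fst (snd (\<phi> t p))) has_real_derivative l2 * fst (snd (\<phi> t p))) (at t)"
    and "((\<lambda>t. snd (snd (\<phi> t p))) has_real_derivative l3 * snd (snd (\<phi> t p))) (at t)"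
proof -
  have X: "X (\<phi> t p) = (l1 * fst (\<phi> t p), l2 * fst (snd (\<phi> t p)), l3 * snd (snd (\<phi> t p)))"
    using assms linear_in_cube by (metis prod.collapse)
  note D = flow_deriv[of p t, unfolded X]
  note D2 = bounded_linear.has_vector_derivative[OF bounded_linear_snd D, simplified]
  show "((\<lambda>t. fst (\<phi> t p)) has_real_derivative l1 * fst (\<phi> t p)) (at t)"
    using bounded_linear.has_vector_derivative[OF bounded_linear_fst D]
    by (simp add: has_real_derivative_iff_has_vector_derivative)
  show "((\<lambda>t. fst (snd (\<phi> t p))) has_real_derivative l2 * fst (snd (\<phi> t p))) (at t)"
    using bounded_linear.has_vector_derivative[OF bounded_linear_fst D2]
    by (simp add: has_real_derivative_iff_has_vector_derivative)
  show "((\<lambda>t. snd (snd (\<phi> t p))) has_real_derivative l3 * snd (snd (\<phi> t p))) (at t)"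
    using bounded_linear.has_vector_derivative[OF bounded_linear_snd D2]
    by (simp add: has_real_derivative_iff_has_vector_derivative)
qed

lemma flow_linear_in_cube:
  assumes "0 \<le> t" and "\<And>s. s \<in> {0..t} \<Longrightarrow> \<phi> s (x, y, z) \<in> lorenz_cube"
  shows "\<phi> t (x, y, z) = (x * exp (l1 * t), y * exp (l2 * t), z * exp (l3 * t))"
  using linear_ode_unique[OF assms(1), of "\<lambda>t. fst (\<phi> t (x, y, z))" l1]
    linear_ode_unique[OF assms(1), of "\<lambda>t. fst (snd (\<phi> t (x, y, z)))" l2]
    linear_ode_unique[OF assms(1), of "\<lambda>t. snd (snd (\<phi> t (x, y, z)))" l3]
    flow_deriv_in_cube[OF assms(2)] flow_zero[of "(x, y, z)"]
  by (simp add: prod_eq_iff)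

text \<open>The solution \<open>t\<close> of
  \<open>\<bar>x\<bar> * exp (l1 * t) = 1\<close>.\<close>

definition exit_time :: "real \<Rightarrow> real" where
  "exit_time x = - ln \<bar>x\<bar> / l1"

lemma exit_time_pos: "(x, y) \<in> lorenz_Sstar \<Longrightarrow> exit_time x > 0"
  using l1_pos by (auto simp: exit_time_def lorenz_Sstar_def lorenz_I_def divide_neg_pos)

text \<open>A continuation argument: the linear formula is valid only while the orbit is in the
  cube, so let \<tau> be the supremum of the times up to which it has stayed. Were \<tau> smaller
  than the exit time, the formula at \<tau> would let the orbit stay a little longer.\<close>

lemma flow_stays_in_cube:
  assumes S: "(x, y) \<in> lorenz_Sstar" and t: "t \<in> {0..exit_time x}"
  shows "\<phi> t (x, y, 1) \<in> lorenz_cube"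
proof -
  define p where "p = (x, y, 1::real)"
  define D where "D = {t \<in> {0..exit_time x}. \<forall>s\<in>{0..t}. \<phi> s p \<in> lorenz_cube}"
  define \<tau> where "\<tau> = Sup D"
  have xy: "\<bar>x\<bar> \<le> 1/2" "\<bar>y\<bar> \<le> 1/2" "x \<noteq> 0"
    using S by (auto simp: lorenz_Sstar_def lorenz_I_def)
  have "0 \<in> D"
    using xy exit_time_pos[OF S] by (auto simp: D_def flow_zero p_def lorenz_cube_def)
  have bdd: "bdd_above D" by (rule bdd_aboveI[of _ "exit_time x"]) (auto simp: D_def)
  have \<tau>0: "0 \<le> \<tau>" unfolding \<tau>_def using \<open>0 \<in> D\<close> bdd by (rule cSup_upper)
  have \<tau>1: "\<tau> \<le> exit_time x" unfolding \<tau>_def using \<open>0 \<in> D\<close> by (intro cSup_least) (auto simp: D_def)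
  have before: "\<phi> s p \<in> lorenz_cube" if s: "0 \<le> s" "s < \<tau>" for s
  proof -
    obtain t where "t \<in> D" "s < t"
      using less_cSupD[of D s] \<open>0 \<in> D\<close> s(2) unfolding \<tau>_def by blast
    then show ?thesis using that by (auto simp: D_def)
  qed
  have clo: "closed lorenz_cube"
    unfolding lorenz_cube_def by (intro closed_Times) auto
  have at_\<tau>: "\<phi> \<tau> p \<in> lorenz_cube"
  proof (cases "\<tau> = 0")
    case True
    then show ?thesis using \<open>0 \<in> D\<close> by (auto simp: D_def)
  next
    case False
    then have "\<tau> > 0" using \<tau>0 by simp
    have lim: "((\<lambda>t. \<phi> t p) \<longlongrightarrow> \<phi> \<tau> p) (at_left \<tau>)"
      using continuous_on_flow[of UNIV p]
      by (auto simp: continuous_on_def intro: tendsto_within_subset)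
    have "eventually (\<lambda>t. \<phi> t p \<in> lorenz_cube) (at_left \<tau>)"
      using eventually_at_left_real[OF \<open>\<tau> > 0\<close>] by eventually_elim (auto intro: before)
    then show ?thesis
      by (rule Lim_in_closed_set[OF clo _ _ lim]) simp
  qed
  have cube: "\<phi> s p \<in> lorenz_cube" if "s \<in> {0..\<tau>}" for s
    using before[of s] at_\<tau> that by (cases "s = \<tau>") auto
  have "\<tau> = exit_time x"
  proof (rule ccontr)
    assume "\<tau> \<noteq> exit_time x"
    then have lt: "\<tau> < exit_time x" using \<tau>1 by simp
    have L: "\<phi> \<tau> p = (x * exp (l1 * \<tau>), y * exp (l2 * \<tau>), exp (l3 * \<tau>))"
      using flow_linear_in_cube[OF \<tau>0, of x y 1] cube by (simp add: p_def)
    have "l1 * \<tau> < - ln \<bar>x\<bar>"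
      using lt l1_pos by (simp add: exit_time_def field_simps)
    then have "exp (l1 * \<tau>) < exp (- ln \<bar>x\<bar>)" by simp
    then have x1: "\<bar>x * exp (l1 * \<tau>)\<bar> < 1"
      using xy by (simp add: exp_minus abs_mult field_simps)
    have "exp (l2 * \<tau>) \<le> 1" using \<tau>0 l2_neg by (simp add: mult_nonpos_nonneg)
    then have "\<bar>y\<bar> * exp (l2 * \<tau>) \<le> 1/2 * 1" using xy by (intro mult_mono) auto
    then have y1: "\<bar>y * exp (l2 * \<tau>)\<bar> < 1" by (simp add: abs_mult)
    have lim: "((\<lambda>t. \<phi> t p) \<longlongrightarrow> \<phi> \<tau> p) (at_right \<tau>)"
      using continuous_on_flow[of UNIV p]
      by (auto simp: continuous_on_def intro: tendsto_within_subset)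
    have "eventually (\<lambda>t. \<bar>fst (\<phi> t p)\<bar> < 1) (at_right \<tau>)"
      using tendsto_rabs[OF tendsto_fst[OF lim]] x1 by (intro order_tendstoD) (auto simp: L)
    moreover have "eventually (\<lambda>t. \<bar>fst (snd (\<phi> t p))\<bar> < 1) (at_right \<tau>)"
      using tendsto_rabs[OF tendsto_fst[OF tendsto_snd[OF lim]]] y1
      by (intro order_tendstoD) (auto simp: L)
    moreover have "eventually (\<lambda>t. 0 < snd (snd (\<phi> t p))) (at_right \<tau>)"
      using tendsto_snd[OF tendsto_snd[OF lim]] by (intro order_tendstoD) (auto simp: L)
    \<comment> \<open>Continuity alone fails at \<open>\<tau> = 0\<close>, where the orbit is on the
      top face; the negative vertical velocity pushes it below.\<close>
    moreover have "eventually (\<lambda>t. snd (snd (\<phi> t p)) < 1) (at_right \<tau>)"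
    proof -
      have "l3 * snd (snd (\<phi> \<tau> p)) < 0" using l3_neg by (simp add: L mult_neg_pos)
      then obtain d where d: "d > 0" "\<And>h. h > 0 \<Longrightarrow> h < d \<Longrightarrow> snd (snd (\<phi> \<tau> p)) > snd (snd (\<phi> (\<tau> + h) p))"
        using DERIV_neg_dec_right[OF flow_deriv_in_cube(3)[OF at_\<tau>]] by blast
      have "snd (snd (\<phi> \<tau> p)) \<le> 1" using \<tau>0 l3_neg by (simp add: L mult_nonpos_nonneg)
      then have "snd (snd (\<phi> t p)) < 1" if "t \<in> {\<tau><..<\<tau> + d}" for t
        using d(2)[of "t - \<tau>"] that by auto
      then show ?thesis
        using eventually_at_right_real[of \<tau> "\<tau> + d"] d(1) by (auto elim: eventually_mono)
    qed
    ultimately have "eventually (\<lambda>t. \<phi> t p \<in> lorenz_cube) (at_right \<tau>)"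
      by eventually_elim (auto simp: lorenz_cube_def mem_Times_iff)
    then obtain e where e: "e > \<tau>" "\<And>t. \<tau> < t \<Longrightarrow> t < e \<Longrightarrow> \<phi> t p \<in> lorenz_cube"
      unfolding eventually_at_right_field by blast
    define u where "u = min ((\<tau> + e) / 2) (exit_time x)"
    have u: "\<tau> < u" "u < e" "u \<le> exit_time x" using e(1) lt by (auto simp: u_def min_less_iff_disj)
    have "u \<in> D"
      unfolding D_def using u \<tau>0 cube e(2) by (auto, metis atLeastAtMost_iff not_less order.strict_trans1)
    then have "u \<le> \<tau>" unfolding \<tau>_def using bdd by (rule cSup_upper)
    then show False using u by simp
  qed
  then show ?thesis using cube t by (simp add: p_def)
qed

lemma flow_until_exit:
  assumes S: "(x, y) \<in> lorenz_Sstar" and t: "t \<in> {0..exit_time x}"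
  shows "\<phi> t (x, y, 1) = (x * exp (l1 * t), y * exp (l2 * t), exp (l3 * t))"
  using flow_linear_in_cube[of t x y 1] flow_stays_in_cube[OF S] t by auto

lemma flow_exit_time:
  assumes S: "(x, y) \<in> lorenz_Sstar"
  shows "\<phi> (exit_time x) (x, y, 1) = (sgn x, y * \<bar>x\<bar> powr \<beta>, \<bar>x\<bar> powr \<alpha>)"
proof -
  have x: "x \<noteq> 0" using S by (auto simp: lorenz_Sstar_def)
  have "x * exp (- ln \<bar>x\<bar>) = sgn x"
    using x by (simp add: exp_minus sgn_if field_simps)
  then show ?thesis
    using flow_until_exit[OF S, of "exit_time x"] exit_time_pos[OF S] l1_pos x
    by (simp add: exit_time_def alpha beta powr_def)
qed

section \<open>The first return to the section\<close>

lemma closed_lorenz_section: "closed lorenz_section"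
proof -
  have "lorenz_section = lorenz_I \<times> lorenz_I \<times> {1}"
    by (auto simp: lorenz_section_def)
  moreover have "closed (lorenz_I \<times> lorenz_I \<times> {1::real})"
    unfolding lorenz_I_def by (intro closed_Times) auto
  ultimately show ?thesis by simp
qed

text \<open>The infimum is attained: return times exist by \<open>exit_points_return\<close>, and
  they form a closed set because none occurs before the exit time.\<close>

lemma first_return_time_props:
  assumes S: "(x, y) \<in> lorenz_Sstar"
  defines "\<tau> \<equiv> first_return_time \<phi> lorenz_section (x, y, 1)"
  shows "\<tau> > 0" and "\<phi> \<tau> (x, y, 1) \<in> lorenz_section"
    and "\<And>t. 0 < t \<Longrightarrow> t < \<tau> \<Longrightarrow> \<phi> t (x, y, 1) \<notin> lorenz_section"
proof -
  define R where "R = {t. 0 < t \<and> \<phi> t (x, y, 1) \<in> lorenz_section}"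
  have lower: "exit_time x < t" if "t \<in> R" for t
  proof (rule ccontr)
    assume "\<not> exit_time x < t"
    then have t: "t \<in> {0..exit_time x}" "t > 0" using that by (auto simp: R_def)
    have "exp (l3 * t) < 1" using t(2) l3_neg by (simp add: mult_neg_pos)
    then show False
      using that flow_until_exit[OF S t(1)] l3_neg t(2) by (auto simp: R_def lorenz_section_def)
  qed
  obtain t where "t > 0" "\<phi> t (sgn x, y * \<bar>x\<bar> powr \<beta>, \<bar>x\<bar> powr \<alpha>) \<in> lorenz_section"
    using exit_points_return S by fastforce
  then have "t + exit_time x \<in> R"
    using exit_time_pos[OF S] by (simp add: R_def flow_add flow_exit_time[OF S])
  have Req: "R = {exit_time x..} \<inter> (\<lambda>t. \<phi> t (x, y, 1)) -` lorenz_section"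
    using lower exit_time_pos[OF S] by (fastforce simp: R_def)
  have "closed R"
    unfolding Req by (intro closed_Int closed_vimage closed_lorenz_section continuous_on_flow) auto
  moreover have bdd: "bdd_below R"
    using lower by (intro bdd_belowI[of _ "exit_time x"]) force
  ultimately have mem: "\<tau> \<in> R"
    using \<open>t + exit_time x \<in> R\<close> unfolding \<tau>_def first_return_time_def R_def[symmetric]
    by (intro closed_contains_Inf) auto
  then show "\<tau> > 0" "\<phi> \<tau> (x, y, 1) \<in> lorenz_section" by (auto simp: R_def)
  show "\<phi> t (x, y, 1) \<notin> lorenz_section" if "0 < t" "t < \<tau>" for t
    using cInf_lower[OF _ bdd, of t] that unfolding \<tau>_def first_return_time_def R_def[symmetric]
    by (auto simp: R_def)
qed

text \<open>Flowing back from a common image, the point with the shorter return time would be an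
  earlier return of the other point. So the return times agree, and then so do the points.\<close>

lemma lorenz_P_inj_on: "inj_on (lorenz_P \<phi>) lorenz_Sstar"
proof (rule inj_onI)
  fix p q :: "real \<times> real"
  assume p: "p \<in> lorenz_Sstar" and q: "q \<in> lorenz_Sstar" and eq: "lorenz_P \<phi> p = lorenz_P \<phi> q"
  define lift :: "real \<times> real \<Rightarrow> real \<times> real \<times> real" where "lift p = (fst p, snd p, 1)" for p
  define \<tau> where "\<tau> p = first_return_time \<phi> lorenz_section (lift p)" for p
  have props: "\<tau> p > 0" "\<phi> (\<tau> p) (lift p) \<in> lorenz_section"
    "\<And>t. 0 < t \<Longrightarrow> t < \<tau> p \<Longrightarrow> \<phi> t (lift p) \<notin> lorenz_section" "lift p \<in> lorenz_section"
    if "p \<in> lorenz_Sstar" for p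
    using first_return_time_props[of "fst p" "snd p"] that
    by (auto simp: \<tau>_def lift_def lorenz_section_def lorenz_Sstar_def)
  have P: "\<phi> (\<tau> p) (lift p) = lift (lorenz_P \<phi> p)" if "p \<in> lorenz_Sstar" for p
    using props(2)[OF that]
    by (auto simp: \<tau>_def lift_def lorenz_P_def first_return_def lorenz_section_def split_beta
        split: prod.splits)
  have rewind: "lift p = \<phi> (\<tau> q - \<tau> p) (lift q)"
    if "p \<in> lorenz_Sstar" "q \<in> lorenz_Sstar" "lorenz_P \<phi> p = lorenz_P \<phi> q" for p q
  proof -
    have "lift p = \<phi> (- \<tau> p) (\<phi> (\<tau> p) (lift p))"
      by (simp add: flow_add[symmetric] flow_zero)
    also have "\<dots> = \<phi> (- \<tau> p) (\<phi> (\<tau> q) (lift q))"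
      using that by (simp add: P)
    finally show ?thesis by (simp add: flow_add[symmetric])
  qed
  have ge: "\<not> \<tau> p < \<tau> q"
    if "p \<in> lorenz_Sstar" "q \<in> lorenz_Sstar" "lorenz_P \<phi> p = lorenz_P \<phi> q" for p q
    using props(3)[OF that(2), of "\<tau> q - \<tau> p"] props(1,4)[OF that(1)] rewind[OF that] by auto
  have "\<tau> p = \<tau> q" using ge[OF p q eq] ge[OF q p] eq by simp
  then have "lift p = lift q" using rewind[OF p q eq] by (simp add: flow_zero)
  then show "p = q" by (simp add: lift_def prod_eq_iff)
qed

end

section \<open>Vertical fibres of the attractor\<close>

context geometric_lorenz_flow
begin

section \<open>Normal forms of \<open>f\<close> and \<open>G\<close>\<close>

lemma alpha_pos: "0 < \<alpha>" and alpha_less_1: "\<alpha> < 1" and beta_pos: "0 < \<beta>"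
  using eigenvalues by (auto simp: alpha beta field_simps)

lemma mem_I_iff: "x \<in> lorenz_I \<longleftrightarrow> \<bar>x\<bar> \<le> 1/2"
  by (auto simp: lorenz_I_def)

lemma mem_Sstar_iff: "(x, y) \<in> lorenz_Sstar \<longleftrightarrow> x \<in> lorenz_I - {0} \<and> y \<in> lorenz_I"
  by (auto simp: lorenz_Sstar_def)

abbreviation f :: "real \<Rightarrow> real" where
  "f \<equiv> lorenz_f \<alpha> \<theta> b"

abbreviation G :: "real \<Rightarrow> real \<Rightarrow> real" where
  "G \<equiv> lorenz_g \<alpha> \<beta> g"

lemma f_right: "x > 0 \<Longrightarrow> f x = \<theta> * x powr \<alpha> + b 0"
  and f_left: "x < 0 \<Longrightarrow> f x = b 1 - \<theta> * (- x) powr \<alpha>"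
  by (auto simp: lorenz_f_def)

lemma b0_eq: "b 0 = -1/2"
proof -
  have "((\<lambda>x. \<theta> * x powr \<alpha> + b 0) \<longlongrightarrow> \<theta> * 0 powr \<alpha> + b 0) (at_right 0)"
    using alpha_pos eventually_at_right_less[of "0::real"]
    by (intro tendsto_intros tendsto_powr') (auto elim: eventually_mono)
  moreover have "eventually (\<lambda>x. \<theta> * x powr \<alpha> + b 0 = f x) (at_right 0)"
    using eventually_at_right_less[of "0::real"] by eventually_elim (simp add: f_right)
  ultimately have "(f \<longlongrightarrow> b 0) (at_right 0)"
    using alpha_pos by (simp add: tendsto_cong)
  then show ?thesis
    using f_at_0(2) tendsto_unique trivial_limit_at_right_real by blast
qed

lemma b1_eq: "b 1 = 1/2"
proof -
  have ev: "eventually (\<lambda>x. x < (0::real)) (at_left 0)"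
    by (simp add: eventually_at_filter)
  have "((\<lambda>x. b 1 - \<theta> * (- x) powr \<alpha>) \<longlongrightarrow> b 1 - \<theta> * (- 0) powr \<alpha>) (at_left 0)"
    using alpha_pos ev
    by (intro tendsto_intros tendsto_powr') (auto elim: eventually_mono)
  moreover have "eventually (\<lambda>x. b 1 - \<theta> * (- x) powr \<alpha> = f x) (at_left 0)"
    using ev by eventually_elim (simp add: f_left)
  ultimately have "(f \<longlongrightarrow> b 1) (at_left 0)"
    using alpha_pos by (simp add: tendsto_cong)
  then show ?thesis
    using f_at_0(1) tendsto_unique trivial_limit_at_left_real by blast
qed

text \<open>\<open>f_expanding\<close> at the endpoint \<open>1/2\<close>; this becomes the
  assumption \<open>slope\<close> of \<open>lorenz_branches\<close>.\<close>

lemma slope_at_half: "sqrt 2 < \<theta> * \<alpha> * (1/2) powr (\<alpha> - 1)"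
proof -
  have "((\<lambda>x. \<theta> * x powr \<alpha> + b 0) has_real_derivative \<theta> * (\<alpha> * (1/2) powr (\<alpha> - 1)) + 0) (at (1/2))"
    by (intro DERIV_add DERIV_cmult has_real_derivative_powr DERIV_const) auto
  then have "(f has_real_derivative \<theta> * (\<alpha> * (1/2) powr (\<alpha> - 1)) + 0) (at (1/2))"
    by (rule has_field_derivative_transform_within_open[of _ _ _ "{0<..}"]) (auto simp: f_right)
  then have "deriv f (1/2) = \<theta> * \<alpha> * (1/2) powr (\<alpha> - 1)"
    by (simp add: DERIV_imp_deriv mult.assoc)
  then show ?thesis using f_expanding[of "1/2"] by (simp add: lorenz_I_def)
qed

lemma theta_positive: "0 < \<theta>"
proof -
  have "0 < \<theta> * (\<alpha> * (1/2) powr (\<alpha> - 1))"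
    using less_trans[OF _ slope_at_half, of 0] by (simp add: mult.assoc)
  moreover have "0 < \<alpha> * (1/2) powr (\<alpha> - 1)"
    using alpha_pos by (intro mult_pos_pos) auto
  ultimately show ?thesis by (rule zero_less_mult_pos2)
qed

sublocale lorenz_branches \<alpha> \<theta>
  using alpha_pos alpha_less_1 theta_positive slope_at_half by unfold_locales

text \<open>\<open>outer t\<close> may lie outside \<open>lorenz_I\<close>, but the formula for
  \<open>f\<close> is valid there as well.\<close>

lemma f_inner: "\<bar>t\<bar> < 1/2 \<Longrightarrow> f (inner t) = t"
  and f_outer: "\<bar>t\<bar> < 1/2 \<Longrightarrow> f (outer t) = t"
  using br_pos[of t] br_pos[of "- t"] br_powr[of t] br_powr[of "- t"]
  by (auto simp: inner_def outer_def f_right f_left b0_eq b1_eq[simplified])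

lemma g_formula:
  assumes "i < 2"
  obtains a d c where "\<And>u v. g i (u, v) = a * u + d * v + c"
proof -
  obtain L c where L: "linear L" "g i = (\<lambda>p. L p + c)" using g_affine[OF assms] by blast
  have "L (u, v) = L (1, 0) * u + L (0, 1) * v" for u v
  proof -
    have "L (u, v) = L (u *\<^sub>R (1, 0) + v *\<^sub>R (0, 1))" by simp
    also have "\<dots> = L (1, 0) * u + L (0, 1) * v"
      by (simp only: linear_add[OF L(1)] linear_scale[OF L(1)]) simp
    finally show ?thesis .
  qed
  then show ?thesis by (intro that[of "L (1, 0)" "L (0, 1)" c]) (metis L(2))
qed

lemma G_continuous:
  "continuous_on {p. fst p > 0} (\<lambda>p. G (fst p) (snd p))"
  "continuous_on {p. fst p < 0} (\<lambda>p. G (fst p) (snd p))"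
proof -
  have 1: "continuous_on {p. fst p > 0} (\<lambda>p. g 0 (\<bar>fst p\<bar> powr \<alpha>, snd p * \<bar>fst p\<bar> powr \<beta>))"
    by (rule g_formula[of 0]) (auto intro!: continuous_intros)
  show "continuous_on {p. fst p > 0} (\<lambda>p. G (fst p) (snd p))"
    by (rule continuous_on_eq[OF 1]) (simp add: lorenz_g_def)
  have 2: "continuous_on {p. fst p < 0} (\<lambda>p. g 1 (\<bar>fst p\<bar> powr \<alpha>, snd p * \<bar>fst p\<bar> powr \<beta>))"
    by (rule g_formula[of 1]) (auto intro!: continuous_intros)
  show "continuous_on {p. fst p < 0} (\<lambda>p. G (fst p) (snd p))"
    by (rule continuous_on_eq[OF 2]) (simp add: lorenz_g_def)
qed

lemma G_affine:
  assumes x: "x \<in> lorenz_I - {0}"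
  obtains p q where "G x = (\<lambda>y. p * y + q)" "\<bar>p\<bar> = \<bar>x\<bar> powr \<beta>"
proof -
  define i :: nat where "i = (if x > 0 then 0 else 1)"
  have "i < 2" by (simp add: i_def)
  obtain a d c where g: "\<And>u v. g i (u, v) = a * u + d * v + c"
    using g_formula[OF \<open>i < 2\<close>] by metis
  have G: "G x = (\<lambda>y. (d * \<bar>x\<bar> powr \<beta>) * y + (a * \<bar>x\<bar> powr \<alpha> + c))"
  proof
    fix y
    have "G x y = g i (\<bar>x\<bar> powr \<alpha>, y * \<bar>x\<bar> powr \<beta>)"
      by (simp add: lorenz_g_def i_def)
    then show "G x y = (d * \<bar>x\<bar> powr \<beta>) * y + (a * \<bar>x\<bar> powr \<alpha> + c)"
      by (simp add: g)
  qed
  have "((\<lambda>y. (d * \<bar>x\<bar> powr \<beta>) * y + (a * \<bar>x\<bar> powr \<alpha> + c)) has_real_derivative d * \<bar>x\<bar> powr \<beta>) (at 0)"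
    by (auto intro!: derivative_eq_intros)
  then have "deriv (\<lambda>y. G x y) 0 = d * \<bar>x\<bar> powr \<beta>"
    unfolding G by (rule DERIV_imp_deriv)
  moreover have "\<bar>deriv (\<lambda>y. G x y) 0\<bar> = \<bar>x\<bar> powr \<beta>"
    using g_deriv_y x by (fastforce simp: mem_Sstar_iff mem_I_iff)
  ultimately show ?thesis using that[OF G] by simp
qed

text \<open>Being an equality, this yields both the contraction that makes heights converge and the
  lower bound that keeps them apart.\<close>

lemma G_diff:
  assumes "x \<in> lorenz_I - {0}"
  shows "\<bar>G x y - G x y'\<bar> = \<bar>x\<bar> powr \<beta> * \<bar>y - y'\<bar>"
proof -
  obtain p q where "G x = (\<lambda>y. p * y + q)" "\<bar>p\<bar> = \<bar>x\<bar> powr \<beta>"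
    using G_affine[OF assms] .
  moreover have "p * y + q - (p * y' + q) = p * (y - y')" by (simp add: algebra_simps)
  ultimately show ?thesis by (simp add: abs_mult)
qed

lemma ex_contraction_rate:
  obtains \<rho> where "0 < \<rho>" "\<rho> < 1" "\<And>x. x \<in> lorenz_I - {0} \<Longrightarrow> \<bar>x\<bar> powr \<beta> \<le> \<rho>"
proof -
  obtain r where r: "0 < r" "r < 1" "\<forall>(x, y) \<in> lorenz_Sstar. \<bar>x\<bar> powr \<beta> < r"
    using g_deriv_y by fastforce
  have "\<bar>x\<bar> powr \<beta> \<le> r" if "x \<in> lorenz_I - {0}" for x
    using r(3) that by (auto simp: mem_Sstar_iff mem_I_iff dest!: bspec[of _ _ "(x, 0)"])
  then show ?thesis using that r by blast
qed

section \<open>Backward orbits and the attractor points above them\<close>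

definition history :: "(nat \<Rightarrow> real) \<Rightarrow> bool" where
  "history x \<longleftrightarrow> (\<forall>k. x (Suc k) \<in> lorenz_I - {0} \<and> f (x (Suc k)) = x k)"

lemma history_shift: "history x \<Longrightarrow> history (\<lambda>k. x (Suc k))"
  by (auto simp: history_def)

text \<open>The height reached over \<open>x 0\<close> when \<open>P\<close> is applied
  \<open>n\<close> times to the point \<open>(x n, 0)\<close>.\<close>

primrec approx :: "nat \<Rightarrow> (nat \<Rightarrow> real) \<Rightarrow> real" where
  "approx 0 x = 0"
| "approx (Suc n) x = G (x 1) (approx n (\<lambda>k. x (Suc k)))"

text \<open>\<open>fibre x\<close> is the height of the point of the attractor over \<open>x 0\<close> whose backward orbit under \<open>P\<close> has
  the first coordinates \<open>x 1, x 2, \<dots>\<close>.\<close>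

definition fibre :: "(nat \<Rightarrow> real) \<Rightarrow> real" where
  "fibre x = lim (\<lambda>n. approx n x)"

lemma approx_mem: "history x \<Longrightarrow> approx n x \<in> lorenz_I"
proof (induction n arbitrary: x)
  case 0
  then show ?case by (simp add: lorenz_I_def)
next
  case (Suc n)
  then show ?case
    using Suc.IH[OF history_shift[OF Suc.prems]] by (auto simp: history_def mem_Sstar_iff intro!: g_range)
qed

text \<open>Consecutive approximations start at different heights over the same \<open>x n\<close>,
  and \<open>n\<close> contractions leave a difference of at most \<open>\<rho> ^ n\<close>, which
  is summable.\<close>

lemma approx_LIMSEQ:
  assumes "history x"
  shows "(\<lambda>n. approx n x) \<longlonglongrightarrow> fibre x"
proof -
  obtain \<rho> where \<rho>: "0 < \<rho>" "\<rho> < 1" and rate: "\<And>x. x \<in> lorenz_I - {0} \<Longrightarrow> \<bar>x\<bar> powr \<beta> \<le> \<rho>"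
    using ex_contraction_rate by metis
  have bound: "\<bar>approx (Suc n) x - approx n x\<bar> \<le> \<rho> ^ n" if "history x" for n x
    using that
  proof (induction n arbitrary: x)
    case 0
    then show ?case using approx_mem[of x 1] by (simp add: mem_I_iff)
  next
    case (Suc n)
    have x1: "x 1 \<in> lorenz_I - {0}" using Suc.prems by (simp add: history_def)
    have "\<bar>approx (Suc (Suc n)) x - approx (Suc n) x\<bar>
      = \<bar>x 1\<bar> powr \<beta> * \<bar>approx (Suc n) (\<lambda>k. x (Suc k)) - approx n (\<lambda>k. x (Suc k))\<bar>"
      unfolding approx.simps(2)[of "Suc n" x] approx.simps(2)[of n x] by (rule G_diff[OF x1])
    also have "\<dots> \<le> \<rho> * \<rho> ^ n"
      using rate[OF x1] Suc.IH[OF history_shift[OF Suc.prems]] \<rho> by (intro mult_mono) auto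
    finally show ?case by simp
  qed
  have "summable (\<lambda>n. \<rho> ^ n)" using \<rho> by (intro summable_geometric) auto
  then have "summable (\<lambda>n. approx (Suc n) x - approx n x)"
    by (rule summable_comparison_test'[where N = 0]) (simp only: real_norm_def bound[OF assms])
  moreover have "(\<Sum>i<n. approx (Suc i) x - approx i x) = approx n x" for n
    using sum_lessThan_telescope[of "\<lambda>i. approx i x" n] by (simp del: approx.simps(2))
  ultimately have "convergent (\<lambda>n. approx n x)"
    by (simp only: summable_iff_convergent)
  then show ?thesis by (simp add: convergent_LIMSEQ_iff fibre_def)
qed

lemma fibre_mem: "history x \<Longrightarrow> fibre x \<in> lorenz_I"
  using closed_sequentially[of lorenz_I, OF _ _ approx_LIMSEQ] approx_mem
  by (simp add: lorenz_I_def)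

lemma fibre_step:
  assumes "history x"
  shows "fibre x = G (x 1) (fibre (\<lambda>k. x (Suc k)))"
proof -
  have "x 1 \<in> lorenz_I - {0}" using assms by (simp add: history_def)
  then obtain p q where G: "G (x 1) = (\<lambda>y. p * y + q)" using G_affine by blast
  have "(\<lambda>n. approx (Suc n) x) \<longlonglongrightarrow> G (x 1) (fibre (\<lambda>k. x (Suc k)))"
    unfolding approx.simps G by (intro tendsto_intros approx_LIMSEQ history_shift assms)
  moreover have "(\<lambda>n. approx (Suc n) x) \<longlonglongrightarrow> fibre x"
    by (rule LIMSEQ_Suc[OF approx_LIMSEQ[OF assms]])
  ultimately show ?thesis by (rule LIMSEQ_unique[rotated])
qed

text \<open>By \<open>fibre_step\<close>, the points \<open>q j\<close> form an infinite backward
  orbit of \<open>P\<close> inside the punctured section, so \<open>q 0\<close> is in every iterated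
  image, even before taking the closure.\<close>

lemma fibre_in_attractor:
  assumes x: "history x"
  shows "(x 0, fibre x) \<in> lorenz_attractor \<phi>"
proof -
  define q where "q j = (x j, fibre (\<lambda>k. x (k + j)))" for j
  have hist: "history (\<lambda>k. x (k + j))" for j
    using x by (auto simp: history_def)
  have S: "q (Suc j) \<in> lorenz_Sstar" for j
    using x fibre_mem[OF hist[of "Suc j"]] by (auto simp: q_def mem_Sstar_iff history_def)
  have P: "lorenz_P \<phi> (q (Suc j)) = q j" for j
    using S[of j] fibre_step[OF hist[of j]] x by (simp add: q_def P_form history_def)
  have Pm: "(lorenz_P \<phi> ^^ m) (q (m + j)) = q j" for m j
    by (induction m) (simp_all add: funpow_Suc_right P del: funpow.simps)
  have "q 0 \<in> iterate_image (lorenz_P \<phi>) lorenz_Sstar i" for i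
  proof -
    have "(lorenz_P \<phi> ^^ j) (q i) \<in> lorenz_Sstar" if "j < i" for j
      using Pm[of j "i - j"] S[of "i - j - 1"] that by (simp add: Suc_diff_Suc)
    then show ?thesis
      unfolding iterate_image_def using Pm[of i 0] by (intro image_eqI[of _ _ "q i"]) auto
  qed
  then show ?thesis
    unfolding lorenz_attractor_def using closure_subset by (force simp: q_def)
qed

text \<open>The margin \<epsilon> makes the two rectangles compact subsets of the punctured section.
  Injectivity of \<open>P\<close> makes their images disjoint, hence a positive distance apart; over
  a common first coordinate that distance is vertical.\<close>

lemma ex_gap:
  assumes "\<epsilon> > 0"
  obtains \<delta> where "\<delta> > 0"
    "\<And>x x' y y'. x \<in> {\<epsilon>..1/2} \<Longrightarrow> x' \<in> {-1/2..-\<epsilon>} \<Longrightarrow> y \<in> lorenz_I \<Longrightarrow> y' \<in> lorenz_I \<Longrightarrow>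
      f x = f x' \<Longrightarrow> \<delta> \<le> \<bar>G x y - G x' y'\<bar>"
proof -
  define Q where "Q p = (f (fst p), G (fst p) (snd p))" for p
  define K1 where "K1 = {\<epsilon>..1/2} \<times> lorenz_I"
  define K2 where "K2 = {-1/2..-\<epsilon>} \<times> lorenz_I"
  have "continuous_on K1 (\<lambda>p. (\<theta> * (fst p) powr \<alpha> + b 0, G (fst p) (snd p)))"
    using assms alpha_pos unfolding K1_def
    by (intro continuous_intros continuous_on_subset[OF G_continuous(1)]) auto
  then have "continuous_on K1 Q"
    by (rule continuous_on_eq) (use assms in \<open>auto simp: Q_def K1_def f_right\<close>)
  moreover have "continuous_on K2 (\<lambda>p. (b 1 - \<theta> * (- fst p) powr \<alpha>, G (fst p) (snd p)))"
    using assms alpha_pos unfolding K2_def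
    by (intro continuous_intros continuous_on_subset[OF G_continuous(2)]) auto
  then have "continuous_on K2 Q"
    by (rule continuous_on_eq) (use assms in \<open>auto simp: Q_def K2_def f_left\<close>)
  moreover have "compact K1" "compact K2"
    by (auto simp: K1_def K2_def lorenz_I_def intro!: compact_Times)
  ultimately have comp: "compact (Q ` K1)" "compact (Q ` K2)"
    by (auto intro: compact_continuous_image)
  have sub: "K1 \<subseteq> lorenz_Sstar" "K2 \<subseteq> lorenz_Sstar" "K1 \<inter> K2 = {}"
    using assms by (auto simp: K1_def K2_def mem_Sstar_iff mem_I_iff)
  have "inj_on Q lorenz_Sstar"
    using lorenz_P_inj_on by (rule inj_on_cong[THEN iffD1, rotated]) (auto simp: Q_def P_form)
  then have "Q ` K1 \<inter> Q ` K2 = {}"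
    using sub by (simp add: inj_on_image_Int[symmetric])
  then obtain \<delta> where \<delta>: "\<delta> > 0" "\<And>p p'. p \<in> Q ` K1 \<Longrightarrow> p' \<in> Q ` K2 \<Longrightarrow> \<delta> \<le> dist p p'"
    using separate_compact_closed[OF comp(1) compact_imp_closed[OF comp(2)]] by blast
  show ?thesis
  proof (rule that[OF \<delta>(1)])
    fix x x' y y'
    assume "x \<in> {\<epsilon>..1/2}" "x' \<in> {-1/2..-\<epsilon>}" "y \<in> lorenz_I" "y' \<in> lorenz_I" and eq: "f x = f x'"
    then have "\<delta> \<le> dist (Q (x, y)) (Q (x', y'))"
      by (intro \<delta>(2)) (auto simp: K1_def K2_def)
    then show "\<delta> \<le> \<bar>G x y - G x' y'\<bar>"
      using eq by (simp add: Q_def dist_Pair_Pair dist_real_def)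
  qed
qed

text \<open>Induction on the length of the common past: \<open>ex_gap\<close> starts it, and each
  shared step multiplies the difference by \<open>\<bar>x 1\<bar> powr \<beta>\<close>, which is at
  least \<open>\<epsilon> powr \<beta>\<close>.\<close>

lemma ex_fibre_separation:
  assumes \<epsilon>: "\<epsilon> > 0"
  obtains \<delta> where "\<delta> > 0"
    "\<And>n x x'. history x \<Longrightarrow> history x' \<Longrightarrow>
      (\<And>k. \<epsilon> \<le> \<bar>x (Suc k)\<bar>) \<Longrightarrow> (\<And>k. \<epsilon> \<le> \<bar>x' (Suc k)\<bar>) \<Longrightarrow>
      (\<And>k. k \<le> n \<Longrightarrow> x k = x' k) \<Longrightarrow> x (Suc n) * x' (Suc n) < 0 \<Longrightarrow>
      (\<epsilon> powr \<beta>) ^ n * \<delta> \<le> \<bar>fibre x - fibre x'\<bar>"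
proof -
  obtain \<delta> where \<delta>: "\<delta> > 0"
    and gap: "\<And>x x' y y'. x \<in> {\<epsilon>..1/2} \<Longrightarrow> x' \<in> {-1/2..-\<epsilon>} \<Longrightarrow> y \<in> lorenz_I \<Longrightarrow> y' \<in> lorenz_I \<Longrightarrow>
      f x = f x' \<Longrightarrow> \<delta> \<le> \<bar>G x y - G x' y'\<bar>"
    using ex_gap[OF \<epsilon>] by metis
  have "(\<epsilon> powr \<beta>) ^ n * \<delta> \<le> \<bar>fibre x - fibre x'\<bar>"
    if "history x" "history x'" "\<And>k. \<epsilon> \<le> \<bar>x (Suc k)\<bar>" "\<And>k. \<epsilon> \<le> \<bar>x' (Suc k)\<bar>"
      "\<And>k. k \<le> n \<Longrightarrow> x k = x' k" "x (Suc n) * x' (Suc n) < 0" for n x x'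
    using that
  proof (induction n arbitrary: x x')
    case (0 x x')
    define y y' where "y = fibre (\<lambda>k. x (Suc k))" and "y' = fibre (\<lambda>k. x' (Suc k))"
    have y: "y \<in> lorenz_I" "y' \<in> lorenz_I"
      using 0 by (auto simp: y_def y'_def intro: fibre_mem history_shift)
    have fib: "fibre x = G (x 1) y" "fibre x' = G (x' 1) y'"
      using fibre_step[OF 0(1)] fibre_step[OF 0(2)] by (simp_all add: y_def y'_def)
    have eq: "f (x 1) = f (x' 1)"
      using 0(1,2) 0(5)[of 0] by (simp add: history_def)
    have I: "\<bar>x 1\<bar> \<le> 1/2" "\<bar>x' 1\<bar> \<le> 1/2" "\<epsilon> \<le> \<bar>x 1\<bar>" "\<epsilon> \<le> \<bar>x' 1\<bar>"
      using 0(1-4) by (auto simp: history_def mem_I_iff)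
    have "x 1 * x' 1 < 0" using 0(6) by simp
    then consider "x 1 > 0" "x' 1 < 0" | "x 1 < 0" "x' 1 > 0"
      by (auto simp: mult_less_0_iff)
    then show ?case
    proof cases
      case 1
      then show ?thesis using gap[of "x 1" "x' 1" y y'] y I eq by (auto simp: fib)
    next
      case 2
      then show ?thesis using gap[of "x' 1" "x 1" y' y] y I eq by (auto simp: fib abs_minus_commute)
    qed
  next
    case (Suc n)
    have x1: "x 1 \<in> lorenz_I - {0}" using Suc.prems by (simp add: history_def)
    have "x 1 = x' 1" using Suc.prems(5) by simp
    then have "\<bar>fibre x - fibre x'\<bar> = \<bar>x 1\<bar> powr \<beta> * \<bar>fibre (\<lambda>k. x (Suc k)) - fibre (\<lambda>k. x' (Suc k))\<bar>"
      using fibre_step Suc.prems(1,2) G_diff[OF x1] by simp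
    also have "\<dots> \<ge> \<epsilon> powr \<beta> * ((\<epsilon> powr \<beta>) ^ n * \<delta>)"
    proof (intro mult_mono)
      show "\<epsilon> powr \<beta> \<le> \<bar>x 1\<bar> powr \<beta>"
        using Suc.prems(3)[of 0] \<epsilon> beta_pos by (intro powr_mono2) auto
      show "(\<epsilon> powr \<beta>) ^ n * \<delta> \<le> \<bar>fibre (\<lambda>k. x (Suc k)) - fibre (\<lambda>k. x' (Suc k))\<bar>"
        by (rule Suc.IH) (use Suc.prems in \<open>auto intro: history_shift\<close>)
    qed (use \<delta> in auto)
    finally show ?case by (simp add: mult.assoc)
  qed
  then show ?thesis using that[OF \<delta>] by blast
qed

section \<open>Hoelder slices of the attractor\<close>

lemma history_hist:
  assumes "\<And>k. \<bar>hist K \<omega> t k\<bar> < 1/2" "\<And>k. hist K \<omega> t (Suc k) \<noteq> 0"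
  shows "history (hist K \<omega> t)"
  unfolding history_def
proof (intro allI conjI)
  fix k
  show "hist K \<omega> t (Suc k) \<in> lorenz_I - {0}"
    using assms(1)[of "Suc k"] assms(2)[of k] by (simp add: mem_I_iff del: hist.simps)
  show "f (hist K \<omega> t (Suc k)) = hist K \<omega> t k"
    using assms(1)[of k] by (simp add: f_inner f_outer)
qed

theorem hausdorff_dim_lorenz_attractor: "hausdorff_dim (lorenz_attractor \<phi>) > 1"
proof -
  obtain K r \<epsilon> where \<epsilon>: "0 < \<epsilon>" and r: "0 < r" "r < 1/2"
    and upper: "\<And>\<omega> t k. \<bar>t\<bar> \<le> r \<Longrightarrow> \<bar>hist K \<omega> t k\<bar> \<le> r"
    and lower: "\<And>\<omega> t k. \<bar>t\<bar> \<le> r \<Longrightarrow> \<epsilon> \<le> \<bar>hist K \<omega> t (Suc k)\<bar>"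
    using ex_uniform_histories by metis
  obtain \<delta> where \<delta>: "\<delta> > 0" and sep: "\<And>n x x'. history x \<Longrightarrow> history x' \<Longrightarrow>
      (\<And>k. \<epsilon> \<le> \<bar>x (Suc k)\<bar>) \<Longrightarrow> (\<And>k. \<epsilon> \<le> \<bar>x' (Suc k)\<bar>) \<Longrightarrow>
      (\<And>k. k \<le> n \<Longrightarrow> x k = x' k) \<Longrightarrow> x (Suc n) * x' (Suc n) < 0 \<Longrightarrow>
      (\<epsilon> powr \<beta>) ^ n * \<delta> \<le> \<bar>fibre x - fibre x'\<bar>"
    using ex_fibre_separation[OF \<epsilon>] by metis
  define \<kappa> where "\<kappa> = \<epsilon> powr \<beta>"
  \<comment> \<open>Both bounds apply to the same point; the outcome \<open>\<kappa> < 1\<close>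
    makes \<open>ln \<kappa>\<close> negative and so \<open>s\<close> positive.\<close>
  have "\<epsilon> \<le> r"
    using lower[of 0 "\<lambda>_. True" 0] upper[of 0 "\<lambda>_. True" "Suc 0"] r by linarith
  then have "\<epsilon> < 1" using r by simp
  then have \<kappa>: "0 < \<kappa>" "\<kappa> < 1"
    using \<epsilon> beta_pos powr_less_mono2[of \<beta> \<epsilon> 1] by (auto simp: \<kappa>_def)
  \<comment> \<open>Chosen so that \<open>(\<kappa> ^ Suc K) powr s = 1/2\<close>: the vertical
    shrinking over one block then matches one binary digit.\<close>
  define s where "s = ln (1/2) / (real (Suc K) * ln \<kappa>)"
  have s: "s > 0"
    unfolding s_def using \<kappa> by (intro divide_neg_neg mult_pos_neg) auto
  have ks: "(\<kappa> ^ Suc K) powr s = 1/2"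
  proof -
    have "s * ln (\<kappa> ^ Suc K) = ln (1/2)"
      using \<kappa> by (simp add: s_def ln_realpow del: power_Suc)
    then show ?thesis using \<kappa> by (simp add: powr_def del: power_Suc)
  qed
  \<comment> \<open>This absorbs the gap and the \<open>K\<close> inner steps before the differing
    choice.\<close>
  define c where "c = (\<kappa> ^ K * \<delta>) powr s"
  have c: "c > 0" using \<kappa> \<delta> by (simp add: c_def)
  define Z where "Z t v = fibre (hist K (binary_digit v) t)" for t v
  have hist: "history (hist K \<omega> t)" if "t \<in> {-r..r}" for \<omega> t
  proof (rule history_hist)
    have t: "\<bar>t\<bar> \<le> r" using that by auto
    show "\<bar>hist K \<omega> t k\<bar> < 1/2" for k using upper[OF t, of \<omega> k] r by simp
    show "hist K \<omega> t (Suc k) \<noteq> 0" for k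
      using lower[OF t, of \<omega> k] \<epsilon> by (simp del: hist.simps)
  qed
  have "ereal (1 + s) \<le> hausdorff_dim (lorenz_attractor \<phi>)"
  proof (rule hausdorff_dim_ge_of_holder_slices[of "- r" r s "1 / c" Z])
    show "(t, Z t v) \<in> lorenz_attractor \<phi>" if "t \<in> {-r..r}" for t v
      using fibre_in_attractor[OF hist[OF that]] by (simp add: Z_def)
    show "\<bar>v - w\<bar> \<le> 1 / c * \<bar>Z t v - Z t w\<bar> powr s"
      if t: "t \<in> {-r..r}" and vw: "v \<in> {0..<1}" "w \<in> {0..<1}" for t v w
    proof (cases "v = w")
      case False
      obtain n where n: "\<And>i. i < n \<Longrightarrow> binary_digit v i = binary_digit w i"
        "binary_digit v n \<noteq> binary_digit w n" "\<bar>v - w\<bar> \<le> (1/2) ^ n"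
        using ex_first_differing_digit[OF vw False] by metis
      have t': "\<bar>t\<bar> \<le> r" using t by auto
      have small: "\<bar>hist K (binary_digit v) t (n * Suc K + K)\<bar> < 1/2"
        using upper[OF t', of "binary_digit v" "n * Suc K + K"] r by linarith
      \<comment> \<open>The backward orbits agree up to index \<open>n * Suc K + K\<close>, where
        digit \<open>n\<close> is read, and have opposite signs at the next index.\<close>
      have "\<kappa> ^ (n * Suc K + K) * \<delta> \<le> \<bar>Z t v - Z t w\<bar>"
        unfolding Z_def \<kappa>_def
        by (rule sep[OF hist[OF t] hist[OF t] lower[OF t'] lower[OF t'] hist_cong_prefix[OF n(1)]
              hist_opposite[OF n(1,2) small]])
      then have "(\<kappa> ^ (n * Suc K + K) * \<delta>) powr s \<le> \<bar>Z t v - Z t w\<bar> powr s"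
        using s \<kappa> \<delta> by (intro powr_mono2) auto
      moreover have "\<kappa> ^ (n * Suc K + K) * \<delta> = (\<kappa> ^ Suc K) ^ n * (\<kappa> ^ K * \<delta>)"
        by (simp only: power_add power_mult mult.commute[of n] mult.assoc)
      moreover have "((\<kappa> ^ Suc K) ^ n * (\<kappa> ^ K * \<delta>)) powr s = ((\<kappa> ^ Suc K) powr s) ^ n * c"
      proof -
        have power: "(a ^ n) powr s = (a powr s) ^ n" if "a > 0" for a :: real
          using that by (induction n) (simp_all add: powr_mult)
        have "((\<kappa> ^ Suc K) ^ n) powr s = ((\<kappa> ^ Suc K) powr s) ^ n"
          by (rule power[OF zero_less_power[OF \<kappa>(1)]])
        moreover have "0 \<le> (\<kappa> ^ Suc K) ^ n" "0 \<le> \<kappa> ^ K * \<delta>" using \<kappa> \<delta> by auto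
        ultimately show ?thesis by (simp only: c_def powr_mult)
      qed
      ultimately have "(1/2) ^ n * c \<le> \<bar>Z t v - Z t w\<bar> powr s" by (simp only: ks)
      then have "\<bar>v - w\<bar> * c \<le> \<bar>Z t v - Z t w\<bar> powr s"
        using n(3) c by (meson mult_right_mono less_imp_le order_trans)
      then show ?thesis using c by (simp add: field_simps)
    qed (use c in simp)
  qed (use r s c in auto)
  moreover have "ereal 1 < ereal (1 + s)"
    unfolding less_ereal.simps using s by linarith
  ultimately show ?thesis
    unfolding one_ereal_def by (rule less_le_trans[rotated])
qed

end

theorem corollary3:
  fixes l1 l2 l3 \<alpha> \<beta> \<theta> :: real
    and X :: "real \<times> real \<times> real \<Rightarrow> real \<times> real \<times> real"
    and \<phi> :: "real \<Rightarrow> real \<times> real \<times> real \<Rightarrow> real \<times> real \<times> real"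
    and b :: "nat \<Rightarrow> real"
    and g :: "nat \<Rightarrow> real \<times> real \<Rightarrow> real"
  assumes "geometric_lorenz_flow l1 l2 l3 \<alpha> \<beta> X \<phi> \<theta> b g"
  shows "hausdorff_dim (lorenz_attractor \<phi>) > 1"
  using assms by (rule geometric_lorenz_flow.hausdorff_dim_lorenz_attractor)

end
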